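(* For every $L\in\mathbf L^{\rm reg}$ and $M\in\mathbf L$, the following are equivalent: (i) there exists a unique (constant speed) geodesic between $[L]$ and $[M]$ in $(\mathbf L/_{\mathbf O},d_{\rm ABW})$; (ii) $\mathrm{rk}((M^\top M)_{t,t})=\mathrm{rk}((M^\top L)_{t,t})$ for all $t=1,\dots,T$. If either is satisfied, $\log_{[L]}([M])$ exists and is given by $$\log_{[L]}([M])=\iota_L^{-1}(MP-L)$$ for some $P\in\mathbf O^*(L,M)$.
   Context: Fix integers $d,T\ge 1$. Write matrices $A\in\mathbb R^{dT\times dT}$ in block form $A=(A_{s,t})_{s,t=1}^T$ with $A_{s,t}\in\mathbb R^{d\times d}$; $(AB)_{t,t}$ is the $t$-th diagonal block of $AB$. $\mathbf L$ is the set of block-lower-triangular matrices ($L_{t,s}=0$ for $s>t$). $\mathbf O=\{\mathrm{diag}(O_1,\dots,O_T): O_t\in\mathbb R^{d\times d}\text{ orthogonal}\}$. $\|\cdot\|_{\rm F}$ is the Frobenius norm. For $L,M\in\mathbf L$, $d_{\rm ABW}(L,M)=\min_{O\in\mathbf O}\|L-MO\|_{\rm F}$ (equal to the adapted Wasserstein distance between the Gaussian processes $LG$ and $MG$), and $\mathbf O^*(L,M)=\{P\in\mathbf O:\|L-MP\|_{\rm F}=d_{\rm ABW}(L,M)\}$. $\mathbf L/_{\mathbf O}$ is the quotient by $L\sim M\iff L=MO$ for some $O\in\mathbf O$, with classes $[L]$ and the induced metric $d_{\rm ABW}$. $\mathbf L^{\rm reg}=\{L\in\mathbf L:(L^\top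 L)_{t,t}\text{ is positive definite for all }t\}$. $\mathcal V(L)=\{V\in\mathbf L:(V^\top L)_{t,t}\text{ is symmetric for all }t\}$. $\mathbf V(L)=\{MP-L:M\in\mathbf L,\ P\in\mathbf O^*(L,M)\}$. Tangent cone: $\Gamma([L])$ is the set of curves $\gamma:[0,1]\to\mathbf L/_{\mathbf O}$ with $\gamma(0)=[L]$ and $d_{\rm ABW}(\gamma(u),\gamma(v))=|u-v|d_{\rm ABW}(\gamma(0),\gamma(1))$ for all $u,v$ (constant speed geodesics); $0\in\Gamma([L])$ is the constant one. A geodesic between $[L]$ and $[M]$ is a $\gamma\in\Gamma([L])$ with $\gamma(1)=[M]$. For $\gamma,\eta\in\Gamma([L])\setminus\{0\}$ the angle $\angle(\gamma,\eta)\in[0,\pi]$ is defined by $$\cos\angle(\gamma,\eta)=\lim_{u\downarrow0}\frac{d_{\rm ABW}^2([L],\gamma(u))+d_{\rm ABW}^2([L],\eta(u))-d_{\rm ABW}^2(\gamma(u),\eta(u))}{2d_{\rm ABW}([L],\gamma(u))\,d_{\rm ABW}([L],\eta(u))}.$$ $\overline\Gamma([L])$ is the completion of $(\Gamma([L])\setminus\{0\})/_{\angle}$ with respect to $\angle$, and $\mathbf T([L])$ is $\overline\Gamma([L])\times[0,\infty)$ with all points $(\gamma,0)$ identified (the tip), with metric $d_{\mathbf T([L])}^2((\gamma,r),(\eta,s))=r^2+s^2-2rs\cos\angle(\gamma,\eta)$. For $L\in\mathbf L^{\rm reg}$, $\iota_L:(\mathbf T([L]),d_{\mathbf T([L])})\to(\mathcal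 V(L),\|\cdot\|_{\rm F})$ is the isometry (distance-preserving bijection) that sends the tip to $0$ and sends $([\gamma]_\angle,r)$ to $rV/\|V\|_{\rm F}$, where $V\in\mathbf V(L)\setminus\{0\}$ is the unique element with $\gamma(u)=[L+uV]$ for all $u\in[0,1]$. Logarithmic map: if there is a unique constant speed geodesic $\gamma$ from $[L]$ to $[M]$, then $\log_{[L]}([M])$ exists and is defined as $([\gamma]_\angle,d_{\rm ABW}([L],[M]))\in\mathbf T([L])$ (the tip if $[M]=[L]$). *)

theory Defs
  imports "HOL-Analysis.Analysis"
begin

text \<open>
  A matrix in block form is indexed by pairs (time, coordinate). The times form a finite linear
  order \<open>'t\<close>, playing the role of \<open>{1..T}\<close>, and the coordinates a finite type \<open>'d\<close>. The library
  norm on such matrices is the Frobenius norm.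
\<close>

type_synonym ('t, 'd) bmat = "real^('t \<times> 'd)^('t \<times> 'd)"

definition block :: "('t::finite, 'd::finite) bmat \<Rightarrow> 't \<Rightarrow> 't \<Rightarrow> real^'d^'d" where
  "block A s t = (\<chi> i j. A $ (s, i) $ (t, j))"

definition block_diag :: "('t::finite \<Rightarrow> real^'d::finite^'d) \<Rightarrow> ('t, 'd) bmat" where
  "block_diag F = (\<chi> p q. if fst p = fst q then F (fst p) $ snd p $ snd q else 0)"

definition symmetric_matrix :: "real^'n^'n \<Rightarrow> bool" where
  "symmetric_matrix A \<longleftrightarrow> transpose A = A"

definition positive_definite :: "real^'n^'n \<Rightarrow> bool" where
  "positive_definite A \<longleftrightarrow> symmetric_matrix A \<and> (\<forall>x. x \<noteq> 0 \<longrightarrow> 0 < x \<bullet> (A *v x))"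

definition block_lower :: "('t::{finite,linorder}, 'd::finite) bmat set" where
  "block_lower = {L. \<forall>s t. t < s \<longrightarrow> block L t s = 0}"

definition block_orth :: "('t::finite, 'd::finite) bmat set" where
  "block_orth = {block_diag F | F. \<forall>t. orthogonal_matrix (F t)}"

definition block_lower_reg :: "('t::{finite,linorder}, 'd::finite) bmat set" where
  "block_lower_reg = {L \<in> block_lower. \<forall>t. positive_definite (block (transpose L ** L) t t)}"

text \<open>The infimum is a minimum: see \<open>abw_dist_attained\<close> below.\<close>

definition abw_dist :: "('t::finite, 'd::finite) bmat \<Rightarrow> ('t, 'd) bmat \<Rightarrow> real" where
  "abw_dist L M = (INF P\<in>block_orth. norm (L - M ** P))"

definition abw_opt :: "('t::finite, 'd::finite) bmat \<Rightarrow> ('t, 'd) bmat \<Rightarrow> ('t, 'd) bmat set" where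
  "abw_opt L M = {P \<in> block_orth. norm (L - M ** P) = abw_dist L M}"

definition sym_dirs :: "('t::{finite,linorder}, 'd::finite) bmat \<Rightarrow> ('t, 'd) bmat set" where
  "sym_dirs L = {V \<in> block_lower. \<forall>t. symmetric_matrix (block (transpose V ** L) t t)}"

definition opt_dirs :: "('t::{finite,linorder}, 'd::finite) bmat \<Rightarrow> ('t, 'd) bmat set" where
  "opt_dirs L = {M ** P - L | M P. M \<in> block_lower \<and> P \<in> abw_opt L M}"


text \<open>
  \<open>lift_dist d X Y\<close> is the common value of \<open>d x y\<close> for representatives \<open>x\<close> of \<open>X\<close> and \<open>y\<close> of \<open>Y\<close>.
\<close>

definition lift_dist :: "('a \<Rightarrow> 'a \<Rightarrow> real) \<Rightarrow> 'a set \<Rightarrow> 'a set \<Rightarrow> real" where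
  "lift_dist d X Y = the_elem ((\<lambda>(x, y). d x y) ` (X \<times> Y))"

definition abw_rel :: "(('t::{finite,linorder}, 'd::finite) bmat \<times> ('t, 'd) bmat) set" where
  "abw_rel = {(L, M). L \<in> block_lower \<and> M \<in> block_lower \<and> (\<exists>P\<in>block_orth. L = M ** P)}"

definition abw_class :: "('t::{finite,linorder}, 'd::finite) bmat \<Rightarrow> ('t, 'd) bmat set" where
  "abw_class L = abw_rel `` {L}"

definition abw_space :: "('t::{finite,linorder}, 'd::finite) bmat set set" where
  "abw_space = block_lower // abw_rel"

abbreviation abw_qdist :: "('t::finite, 'd::finite) bmat set \<Rightarrow> ('t, 'd) bmat set \<Rightarrow> real" where
  "abw_qdist \<equiv> lift_dist abw_dist"


text \<open>
  Curves are extensional functions on \<open>{0..1}\<close>, so that equality of functions is equality of curves.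
\<close>

type_synonym ('t, 'd) curve = "real \<Rightarrow> ('t, 'd) bmat set"

definition geodesics_from ::
    "('t::{finite,linorder}, 'd::finite) bmat set \<Rightarrow> ('t, 'd) curve set" where
  "geodesics_from X = {\<gamma> \<in> {0..1} \<rightarrow>\<^sub>E abw_space. \<gamma> 0 = X \<and>
     (\<forall>u\<in>{0..1}. \<forall>v\<in>{0..1}. abw_qdist (\<gamma> u) (\<gamma> v) = \<bar>u - v\<bar> * abw_qdist (\<gamma> 0) (\<gamma> 1))}"

definition geodesics_between :: "('t::{finite,linorder}, 'd::finite) bmat set \<Rightarrow>
    ('t, 'd) bmat set \<Rightarrow> ('t, 'd) curve set" where
  "geodesics_between X Y = {\<gamma> \<in> geodesics_from X. \<gamma> 1 = Y}"

definition nonconst_geodesics ::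
    "('t::{finite,linorder}, 'd::finite) bmat set \<Rightarrow> ('t, 'd) curve set" where
  "nonconst_geodesics X = geodesics_from X - {restrict (\<lambda>_. X) {0..1}}"

definition geo_angle :: "('t::{finite,linorder}, 'd::finite) bmat set \<Rightarrow>
    ('t, 'd) curve \<Rightarrow> ('t, 'd) curve \<Rightarrow> real" where
  "geo_angle X \<gamma> \<eta> = arccos (Lim (at_right 0) (\<lambda>u.
     ((abw_qdist X (\<gamma> u))\<^sup>2 + (abw_qdist X (\<eta> u))\<^sup>2 - (abw_qdist (\<gamma> u) (\<eta> u))\<^sup>2)
       / (2 * abw_qdist X (\<gamma> u) * abw_qdist X (\<eta> u))))"

definition angle_rel :: "('t::{finite,linorder}, 'd::finite) bmat set \<Rightarrow>
    (('t, 'd) curve \<times> ('t, 'd) curve) set" where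
  "angle_rel X = {(\<gamma>, \<eta>). \<gamma> \<in> nonconst_geodesics X \<and> \<eta> \<in> nonconst_geodesics X \<and>
     geo_angle X \<gamma> \<eta> = 0}"


text \<open>Completion of a metric space: Cauchy sequences modulo distance tending to zero.\<close>

definition cauchy_seqs :: "'a set \<Rightarrow> ('a \<Rightarrow> 'a \<Rightarrow> real) \<Rightarrow> (nat \<Rightarrow> 'a) set" where
  "cauchy_seqs S d = {x. range x \<subseteq> S \<and> (\<forall>e>0. \<exists>N. \<forall>m\<ge>N. \<forall>n\<ge>N. d (x m) (x n) < e)}"

definition completion_rel ::
    "'a set \<Rightarrow> ('a \<Rightarrow> 'a \<Rightarrow> real) \<Rightarrow> ((nat \<Rightarrow> 'a) \<times> (nat \<Rightarrow> 'a)) set" where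
  "completion_rel S d = {(x, y). x \<in> cauchy_seqs S d \<and> y \<in> cauchy_seqs S d \<and>
     (\<lambda>n. d (x n) (y n)) \<longlonglongrightarrow> 0}"

definition completion :: "'a set \<Rightarrow> ('a \<Rightarrow> 'a \<Rightarrow> real) \<Rightarrow> (nat \<Rightarrow> 'a) set set" where
  "completion S d = cauchy_seqs S d // completion_rel S d"

definition completion_dist ::
    "('a \<Rightarrow> 'a \<Rightarrow> real) \<Rightarrow> (nat \<Rightarrow> 'a) set \<Rightarrow> (nat \<Rightarrow> 'a) set \<Rightarrow> real" where
  "completion_dist d = lift_dist (\<lambda>x y. lim (\<lambda>n. d (x n) (y n)))"

definition completion_embed ::
    "'a set \<Rightarrow> ('a \<Rightarrow> 'a \<Rightarrow> real) \<Rightarrow> 'a \<Rightarrow> (nat \<Rightarrow> 'a) set" where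
  "completion_embed S d x = completion_rel S d `` {\<lambda>_. x}"


text \<open>Cone over a space of directions: \<open>S \<times> [0,\<infinity>)\<close> with all points \<open>(x, 0)\<close> identified.\<close>

definition cone_rel :: "'a set \<Rightarrow> (('a \<times> real) \<times> ('a \<times> real)) set" where
  "cone_rel S = {(p, q). p \<in> S \<times> {0..} \<and> q \<in> S \<times> {0..} \<and> (p = q \<or> snd p = 0 \<and> snd q = 0)}"

definition cone :: "'a set \<Rightarrow> ('a \<times> real) set set" where
  "cone S = (S \<times> {0..}) // cone_rel S"

definition cone_point :: "'a set \<Rightarrow> 'a \<Rightarrow> real \<Rightarrow> ('a \<times> real) set" where
  "cone_point S x r = cone_rel S `` {(x, r)}"

definition cone_tip :: "'a set \<Rightarrow> ('a \<times> real) set" where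
  "cone_tip S = S \<times> {0}"

definition cone_dist ::
    "('a \<Rightarrow> 'a \<Rightarrow> real) \<Rightarrow> ('a \<times> real) set \<Rightarrow> ('a \<times> real) set \<Rightarrow> real" where
  "cone_dist ang = lift_dist (\<lambda>(x, r) (y, s). sqrt (r\<^sup>2 + s\<^sup>2 - 2 * r * s * cos (ang x y)))"


type_synonym ('t, 'd) direction = "(nat \<Rightarrow> ('t, 'd) curve set) set"
type_synonym ('t, 'd) tangent = "(('t, 'd) direction \<times> real) set"

definition geo_dirs ::
    "('t::{finite,linorder}, 'd::finite) bmat set \<Rightarrow> ('t, 'd) curve set set" where
  "geo_dirs X = nonconst_geodesics X // angle_rel X"

abbreviation dir_angle :: "('t::{finite,linorder}, 'd::finite) bmat set \<Rightarrow>
    ('t, 'd) curve set \<Rightarrow> ('t, 'd) curve set \<Rightarrow> real" where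
  "dir_angle X \<equiv> lift_dist (geo_angle X)"

definition dir_space ::
    "('t::{finite,linorder}, 'd::finite) bmat set \<Rightarrow> ('t, 'd) direction set" where
  "dir_space X = completion (geo_dirs X) (dir_angle X)"

definition dir_of :: "('t::{finite,linorder}, 'd::finite) bmat set \<Rightarrow>
    ('t, 'd) curve \<Rightarrow> ('t, 'd) direction" where
  "dir_of X \<gamma> = completion_embed (geo_dirs X) (dir_angle X) (angle_rel X `` {\<gamma>})"

definition tangent_cone ::
    "('t::{finite,linorder}, 'd::finite) bmat set \<Rightarrow> ('t, 'd) tangent set" where
  "tangent_cone X = cone (dir_space X)"

definition tangent_tip ::
    "('t::{finite,linorder}, 'd::finite) bmat set \<Rightarrow> ('t, 'd) tangent" where
  "tangent_tip X = cone_tip (dir_space X)"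

definition tangent_vec :: "('t::{finite,linorder}, 'd::finite) bmat set \<Rightarrow>
    ('t, 'd) curve \<Rightarrow> real \<Rightarrow> ('t, 'd) tangent" where
  "tangent_vec X \<gamma> r = cone_point (dir_space X) (dir_of X \<gamma>) r"

definition tangent_dist :: "('t::{finite,linorder}, 'd::finite) bmat set \<Rightarrow>
    ('t, 'd) tangent \<Rightarrow> ('t, 'd) tangent \<Rightarrow> real" where
  "tangent_dist X = cone_dist (completion_dist (dir_angle X))"


definition geodesic_dir :: "('t::{finite,linorder}, 'd::finite) bmat \<Rightarrow>
    ('t, 'd) curve \<Rightarrow> ('t, 'd) bmat" where
  "geodesic_dir L \<gamma> = (THE V. V \<in> opt_dirs L - {0} \<and> (\<forall>u\<in>{0..1}. \<gamma> u = abw_class (L + u *\<^sub>R V)))"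

definition tangent_iso :: "('t::{finite,linorder}, 'd::finite) bmat \<Rightarrow>
    ('t, 'd) tangent \<Rightarrow> ('t, 'd) bmat" where
  "tangent_iso L = (THE f.
     f \<in> extensional (tangent_cone (abw_class L)) \<and>
     bij_betw f (tangent_cone (abw_class L)) (sym_dirs L) \<and>
     (\<forall>x\<in>tangent_cone (abw_class L). \<forall>y\<in>tangent_cone (abw_class L).
        norm (f x - f y) = tangent_dist (abw_class L) x y) \<and>
     f (tangent_tip (abw_class L)) = 0 \<and>
     (\<forall>\<gamma>\<in>nonconst_geodesics (abw_class L). \<forall>r\<ge>0.
        f (tangent_vec (abw_class L) \<gamma> r) =
          (r / norm (geodesic_dir L \<gamma>)) *\<^sub>R geodesic_dir L \<gamma>))"

text \<open>
  The logarithm is partial; \<open>None\<close> means that it does not exist. The constant geodesic has no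
  direction, hence the separate treatment of the tip.
\<close>

definition log_map :: "('t::{finite,linorder}, 'd::finite) bmat set \<Rightarrow>
    ('t, 'd) bmat set \<Rightarrow> ('t, 'd) tangent option" where
  "log_map X Y =
     (if \<exists>!\<gamma>. \<gamma> \<in> geodesics_between X Y
      then Some (if Y = X then tangent_tip X
                 else tangent_vec X (THE \<gamma>. \<gamma> \<in> geodesics_between X Y) (abw_qdist X Y))
      else None)"


lemma block_diag_mult: "block_diag F ** block_diag G = block_diag (\<lambda>t. F t ** G t)"
proof -
  have "(\<Sum>k\<in>UNIV. block_diag F $ (s, i) $ k * block_diag G $ k $ (t, j))
      = (\<Sum>r\<in>UNIV. \<Sum>k\<in>UNIV. block_diag F $ (s, i) $ (r, k) * block_diag G $ (r, k) $ (t, j))" for s t i j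
    by (simp add: sum.cartesian_product UNIV_Times_UNIV split_beta)
  moreover have "(\<Sum>r\<in>UNIV. \<Sum>k\<in>UNIV. block_diag F $ (s, i) $ (r, k) * block_diag G $ (r, k) $ (t, j)) = (\<Sum>r\<in>UNIV. if r = s then
      (if s = t then \<Sum>k\<in>UNIV. F s $ i $ k * G s $ k $ j else 0) else 0)" for s t i j
    by (intro sum.cong) (auto simp: block_diag_def)
  ultimately show ?thesis
    by (auto simp: matrix_matrix_mult_def vec_eq_iff) (auto simp: block_diag_def)
qed

lemma block_diag_one: "block_diag (\<lambda>_. mat 1) = mat 1"
  by (auto simp: block_diag_def mat_def vec_eq_iff prod_eq_iff)

lemma transpose_block_diag: "transpose (block_diag F) = block_diag (\<lambda>t. transpose (F t))"
  by (auto simp: block_diag_def transpose_def vec_eq_iff)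

lemma block_diag_inject: "block_diag F = block_diag G \<longleftrightarrow> F = G"
proof
  assume "block_diag F = block_diag G"
  then have "block_diag F $ (t, i) $ (t, j) = block_diag G $ (t, i) $ (t, j)" for t i j
    by simp
  then show "F = G"
    by (simp add: block_diag_def fun_eq_iff vec_eq_iff)
qed simp

lemma orthogonal_block_diag:
  "orthogonal_matrix (block_diag F) \<longleftrightarrow> (\<forall>t. orthogonal_matrix (F t))"
  by (simp add: orthogonal_matrix transpose_block_diag block_diag_mult
      block_diag_one[symmetric] block_diag_inject fun_eq_iff)

lemma block_orth_altdef:
  "block_orth = {P :: ('t::finite, 'd::finite) bmat. (\<forall>p q. fst p \<noteq> fst q \<longrightarrow> P $ p $ q = 0) \<and> orthogonal_matrix P}"
proof -
  have "P = block_diag (\<lambda>t. block P t t)" if "\<forall>p q. fst p \<noteq> fst q \<longrightarrow> P $ p $ q = 0"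
    for P :: "('t, 'd) bmat"
    using that by (auto simp: block_diag_def block_def vec_eq_iff)
  then have "\<exists>F. P = block_diag F \<and> (\<forall>t. orthogonal_matrix (F t))"
    if "\<forall>p q. fst p \<noteq> fst q \<longrightarrow> P $ p $ q = 0" "orthogonal_matrix P" for P :: "('t, 'd) bmat"
    using that by (metis orthogonal_block_diag)
  moreover have "block_diag F $ p $ q = 0" if "fst p \<noteq> fst q" for F p q
    using that by (simp add: block_diag_def)
  ultimately show ?thesis
    unfolding block_orth_def by (auto simp: orthogonal_block_diag)
qed

lemma compact_block_orth: "compact (block_orth :: ('t::finite, 'd::finite) bmat set)"
proof -
  have "norm P \<le> real CARD('t \<times> 'd)" if "P \<in> block_orth" for P :: "('t, 'd) bmat"
  proof -
    have "norm (P $ p) = 1" for p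
      using that unfolding block_orth_altdef orthogonal_matrix_orthonormal_rows row_def
      by (simp del: split_paired_All)
    then show ?thesis
      using L2_set_le_sum[of UNIV "\<lambda>p. norm (P $ p)"] by (simp add: norm_vec_def)
  qed
  then have "bounded (block_orth :: ('t, 'd) bmat set)"
    by (auto simp: bounded_iff)
  moreover have "closed (block_orth :: ('t, 'd) bmat set)"
    unfolding block_orth_altdef orthogonal_matrix matrix_matrix_mult_def transpose_def
    by (intro closed_Collect_conj closed_Collect_all closed_Collect_imp closed_Collect_eq
        open_Collect_const continuous_intros)
  ultimately show ?thesis
    by (simp add: compact_eq_bounded_closed)
qed

lemma mat_1_in_block_orth: "mat 1 \<in> block_orth"
  by (auto simp: block_orth_altdef orthogonal_matrix_id) (simp add: mat_def)

lemma abw_dist_attained: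
  fixes L M :: "('t::finite, 'd::finite) bmat"
  shows "\<exists>P\<in>block_orth. norm (L - M ** P) = abw_dist L M"
proof -
  have "continuous_on block_orth (\<lambda>P. norm (L - M ** P))"
    unfolding matrix_matrix_mult_def by (intro continuous_intros)
  then obtain P where P: "P \<in> block_orth" "\<And>Q. Q \<in> block_orth \<Longrightarrow> norm (L - M ** P) \<le> norm (L - M ** Q)"
    using continuous_attains_inf[OF compact_block_orth] mat_1_in_block_orth by blast
  then have "abw_dist L M = norm (L - M ** P)"
    unfolding abw_dist_def by (intro cInf_eq_minimum) auto
  with P show ?thesis by metis
qed

lemma equiv_abw_rel:
  "equiv block_lower (abw_rel :: (('t::{finite,linorder}, 'd::finite) bmat \<times> ('t, 'd) bmat) set)"
proof (rule equivI)
  show "(abw_rel :: (('t, 'd) bmat \<times> ('t, 'd) bmat) set) \<subseteq> block_lower \<times> block_lower" by (auto simp: abw_rel_def)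
  show "refl_on block_lower (abw_rel :: (('t, 'd) bmat \<times> ('t, 'd) bmat) set)"
    using mat_1_in_block_orth by (auto simp: refl_on_def abw_rel_def intro!: bexI[of _ "mat 1"])
  have inv: "transpose P \<in> block_orth \<and> P ** transpose P = mat 1" if "P \<in> block_orth" for P :: "('t, 'd) bmat"
    using that unfolding block_orth_altdef
    by (auto simp: orthogonal_matrix_transpose orthogonal_matrix_def) (simp add: transpose_def)
  have mult: "P ** Q \<in> block_orth" if "P \<in> block_orth" "Q \<in> block_orth" for P Q :: "('t, 'd) bmat"
    using that unfolding block_orth_def by (auto simp: block_diag_mult orthogonal_matrix_mul)
  show "sym (abw_rel :: (('t, 'd) bmat \<times> ('t, 'd) bmat) set)"
    unfolding sym_def abw_rel_def
    by clarsimp (metis inv matrix_mul_assoc matrix_mul_rid)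
  show "trans (abw_rel :: (('t, 'd) bmat \<times> ('t, 'd) bmat) set)"
    unfolding trans_def abw_rel_def
    by clarsimp (metis mult matrix_mul_assoc)
qed

end

theory Submission
  imports Defs
begin

text \<open>
  Write \<open>S\<^sub>t\<close> for the \<open>t\<close>-th diagonal block of \<open>N\<^sup>T L\<close>. Expanding the norm, \<open>\<parallel>L - N P\<parallel>\<close> is minimal at
  \<open>P = 1\<close> iff \<open>\<langle>S\<^sub>t, Q\<rangle> \<le> \<langle>S\<^sub>t, 1\<rangle>\<close> for all orthogonal \<open>Q\<close>, that is, iff every \<open>S\<^sub>t\<close> is positive
  semidefinite; \<open>N P\<close> is then also optimal iff \<open>S\<^sub>t P\<^sub>t = S\<^sub>t\<close> for all \<open>t\<close>. Segments between
  aligned matrices project to geodesics. Conversely, for regular \<open>L\<close> the equality case of the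
  triangle inequality shows that every geodesic from \<open>[L]\<close> is such a segment, and it determines its
  direction. Hence the geodesics from \<open>[L]\<close> to \<open>[M]\<close> correspond to the matrices \<open>M P\<close> with \<open>P\<close>
  optimal, and these coincide iff \<open>S\<^sub>t x = 0\<close> implies \<open>N\<^sub>t x = 0\<close> for \<open>N = M P\<close> with column blocks
  \<open>N\<^sub>t\<close>, which is the rank condition.

  The distance of \<open>[L + u V]\<close> and \<open>[L + u W]\<close> is \<open>u \<parallel>V - W\<parallel>\<close> up to higher order, so the angle of two
  geodesics is the Euclidean angle of their directions. Every element of \<open>sym_dirs L\<close> is a
  multiple of such a direction, so the space of directions is already the full unit sphere
  of \<open>sym_dirs L\<close>; it is complete, and the cone over it is \<open>sym_dirs L\<close>.
\<close>

section \<open>Linear algebra\<close>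

lemma inner_matrix_mult_left:
  fixes A :: "real^'n^'m"
  shows "(A ** B) \<bullet> C = B \<bullet> (transpose A ** C)"
proof -
  have "(A ** B) \<bullet> C = (\<Sum>i\<in>UNIV. \<Sum>j\<in>UNIV. \<Sum>k\<in>UNIV. A$i$k * B$k$j * C$i$j)"
    by (simp add: inner_vec_def matrix_matrix_mult_def sum_distrib_right)
  also have "\<dots> = (\<Sum>i\<in>UNIV. \<Sum>k\<in>UNIV. \<Sum>j\<in>UNIV. A$i$k * B$k$j * C$i$j)"
    by (rule sum.cong[OF refl], rule sum.swap)
  also have "\<dots> = (\<Sum>k\<in>UNIV. \<Sum>i\<in>UNIV. \<Sum>j\<in>UNIV. A$i$k * B$k$j * C$i$j)"
    by (rule sum.swap)
  also have "\<dots> = (\<Sum>k\<in>UNIV. \<Sum>j\<in>UNIV. \<Sum>i\<in>UNIV. A$i$k * B$k$j * C$i$j)"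
    by (rule sum.cong[OF refl], rule sum.swap)
  also have "\<dots> = B \<bullet> (transpose A ** C)"
    by (simp add: inner_vec_def matrix_matrix_mult_def transpose_def sum_distrib_left mult_ac)
  finally show ?thesis .
qed

lemma inner_transpose_transpose: "transpose A \<bullet> transpose B = A \<bullet> B" for A :: "real^'n^'m"
  by (subst (1 2) inner_vec_def) (simp add: inner_vec_def transpose_def, rule sum.swap)

lemma inner_matrix_mult_right:
  fixes A :: "real^'n^'m"
  shows "(A ** B) \<bullet> C = A \<bullet> (C ** transpose B)"
proof -
  have "(A ** B) \<bullet> C = (transpose B ** transpose A) \<bullet> transpose C"
    by (metis inner_transpose_transpose matrix_transpose_mul)
  also have "\<dots> = transpose A \<bullet> transpose (C ** transpose B)"
    by (simp add: inner_matrix_mult_left matrix_transpose_mul)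
  finally show ?thesis by (simp add: inner_transpose_transpose)
qed

lemma matrix_diff_ldistrib: "A ** (B - C) = A ** B - A ** C" for A :: "real^'n^'m"
  by (simp add: matrix_matrix_mult_def vec_eq_iff sum_subtractf right_diff_distrib)

lemma matrix_diff_rdistrib: "(B - C) ** A = B ** A - C ** A" for A :: "real^'n^'m"
  by (simp add: matrix_matrix_mult_def vec_eq_iff sum_subtractf left_diff_distrib)

lemma matrix_add_rdistrib: "(B + C) ** A = B ** A + C ** A" for A :: "real^'n^'m"
  by (simp add: matrix_matrix_mult_def vec_eq_iff sum.distrib distrib_right)

lemma transpose_add: "transpose (A + B) = transpose A + transpose B" for A B :: "real^'n^'m"
  by (simp add: transpose_def vec_eq_iff)

lemma matrix_mult_scaleR: "A ** (c *\<^sub>R B) = c *\<^sub>R (A ** B)" "(c *\<^sub>R A) ** B = c *\<^sub>R (A ** B)"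
  for A :: "real^'n^'m"
  by (simp_all add: matrix_scalar_ac scalar_matrix_assoc)

lemma matrix_vector_inner: "(A *v x) \<bullet> y = x \<bullet> (transpose A *v y)" for A :: "real^'n^'m"
  by (metis dot_lmul_matrix inner_commute vector_transpose_matrix transpose_transpose)

lemma inner_matrix_columns:
  fixes A B :: "real^'n^'m"
  shows "A \<bullet> B = (\<Sum>j\<in>UNIV. column j A \<bullet> column j B)"
  by (simp add: inner_vec_def column_def) (rule sum.swap)

lemma column_matrix_mult: "column j (A ** B) = A *v column j B"
  by (simp add: column_def matrix_matrix_mult_def matrix_vector_mult_def vec_eq_iff)

lemma matrix_eq_0_columns: "A = 0 \<longleftrightarrow> (\<forall>j. column j A = 0)" for A :: "real^'n^'m"
  by (auto simp: column_def vec_eq_iff)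

section \<open>Positive semidefinite matrices paired with orthogonal ones\<close>

definition positive_semidefinite :: "real^'n^'n \<Rightarrow> bool" where
  "positive_semidefinite A \<longleftrightarrow> symmetric_matrix A \<and> (\<forall>x. 0 \<le> x \<bullet> (A *v x))"

text \<open>Near \<open>t = 0\<close> a nonzero linear term would dominate and change sign. This
  extracts first-order conditions from one-parameter variations.\<close>

lemma quadratic_coefficient_eq_0:
  fixes a b :: real
  assumes "\<And>t. 0 \<le> t\<^sup>2 * a + t * b"
  shows "b = 0"
proof (rule ccontr)
  assume "b \<noteq> 0"
  \<comment> \<open>Any \<open>c\<close> above both \<open>a\<close> and \<open>0\<close> works: at
    \<open>t = - b / c\<close> the polynomial equals \<open>b^2 * (a - c) / c^2\<close>, which is
    negative.\<close>
  define c where "c = \<bar>a\<bar> + 1"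
  have c: "c > 0" "a < c" by (auto simp: c_def)
  have "0 \<le> (- b / c)\<^sup>2 * a + (- b / c) * b" by (rule assms)
  also have "\<dots> = b\<^sup>2 * (a - c) / c\<^sup>2"
    using c by (simp add: field_simps power2_eq_square)
  also have "\<dots> < 0"
    using c \<open>b \<noteq> 0\<close> by (simp add: divide_less_0_iff mult_less_0_iff)
  finally show False by simp
qed

text \<open>The quadratic form attains its minimum \<open>0\<close> at \<open>x\<close>, so its
  derivative in the direction \<open>A *v x\<close>, which is twice the squared norm of
  \<open>A *v x\<close>, must vanish.\<close>

lemma positive_semidefinite_null:
  fixes A :: "real^'n^'n"
  assumes A: "positive_semidefinite A" and x: "x \<bullet> (A *v x) = 0"
  shows "A *v x = 0"
proof -
  define y where "y = A *v x"
  have sym: "(A *v u) \<bullet> v = u \<bullet> (A *v v)" for u v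
    using A by (simp add: positive_semidefinite_def symmetric_matrix_def matrix_vector_inner)
  have "0 \<le> t\<^sup>2 * (y \<bullet> (A *v y)) + t * (2 * (y \<bullet> y))" for t
  proof -
    have "0 \<le> (x + t *\<^sub>R y) \<bullet> (A *v (x + t *\<^sub>R y))"
      using A by (simp add: positive_semidefinite_def)
    also have "\<dots> = t\<^sup>2 * (y \<bullet> (A *v y)) + t * (2 * (y \<bullet> y))"
      using x sym[of x y]
      by (simp add: matrix_vector_right_distrib matrix_vector_mult_scaleR inner_add_left
          inner_add_right y_def power2_eq_square algebra_simps)
    finally show ?thesis .
  qed
  from quadratic_coefficient_eq_0[OF this] show ?thesis
    by (simp add: y_def)
qed

lemma inner_conjugate_columns:
  fixes S :: "real^'n^'n" and C :: "real^'m^'n"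
  shows "C \<bullet> (S ** C) = (\<Sum>j\<in>UNIV. column j C \<bullet> (S *v column j C))"
  by (simp add: inner_matrix_columns column_matrix_mult)

text \<open>Expand the left side: the term quadratic in \<open>P\<close> collapses to
  \<open>S \<bullet> mat 1\<close> because \<open>P ** transpose P = mat 1\<close>. The linear gap
  on the right thereby becomes a quadratic form in the columns of \<open>mat 1 - P\<close>.\<close>

lemma symmetric_inner_orthogonal:
  fixes S P :: "real^'n^'n"
  assumes "symmetric_matrix S" "orthogonal_matrix P"
  shows "(mat 1 - P) \<bullet> (S ** (mat 1 - P)) = 2 * (S \<bullet> (mat 1 - P))"
proof -
  have T: "transpose S = S" "transpose P ** P = mat 1" "P ** transpose P = mat 1"
    using assms by (auto simp: symmetric_matrix_def orthogonal_matrix_def)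
  have "P \<bullet> (S ** P) = (S ** P) \<bullet> P"
    by (rule inner_commute)
  also have "\<dots> = S \<bullet> mat 1"
    by (simp add: inner_matrix_mult_right T)
  finally have 1: "P \<bullet> (S ** P) = S \<bullet> mat 1" .
  have 2: "mat 1 \<bullet> (S ** P) = S \<bullet> P"
    using inner_matrix_mult_left[of S P "mat 1"] by (simp add: T inner_commute)
  have 3: "P \<bullet> S = S \<bullet> P" by (rule inner_commute)
  show ?thesis
    by (simp add: matrix_diff_ldistrib inner_diff_left inner_diff_right 1 2 3 inner_commute[of "mat 1" S])
qed

text \<open>Twice the gap \<open>S \<bullet> (mat 1 - P)\<close> is the sum of the quadratic form of
  \<open>S\<close> over the columns of \<open>mat 1 - P\<close>. It is nonnegative, and it vanishes
  only if \<open>S\<close> kills each of these columns.\<close>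

lemma positive_semidefinite_inner_orthogonal:
  fixes S P :: "real^'n^'n"
  assumes S: "positive_semidefinite S" and P: "orthogonal_matrix P"
  shows "S \<bullet> P \<le> S \<bullet> mat 1" and "S \<bullet> P = S \<bullet> mat 1 \<Longrightarrow> S ** P = S"
proof -
  let ?C = "mat 1 - P"
  have nn: "0 \<le> column j ?C \<bullet> (S *v column j ?C)" for j
    using S by (auto simp: positive_semidefinite_def)
  have eq: "2 * (S \<bullet> ?C) = (\<Sum>j\<in>UNIV. column j ?C \<bullet> (S *v column j ?C))"
    using symmetric_inner_orthogonal[of S P] S P
    by (simp add: inner_conjugate_columns positive_semidefinite_def)
  with nn have "0 \<le> S \<bullet> ?C"
    by (metis (mono_tags, lifting) sum_nonneg mult_le_0_iff not_numeral_le_zero zero_le_mult_iff)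
  then show "S \<bullet> P \<le> S \<bullet> mat 1" by (simp add: inner_diff_right)
  assume "S \<bullet> P = S \<bullet> mat 1"
  then have "(\<Sum>j\<in>UNIV. column j ?C \<bullet> (S *v column j ?C)) = 0"
    using eq by (simp add: inner_diff_right)
  then have "column j ?C \<bullet> (S *v column j ?C) = 0" for j
    using nn by (subst (asm) sum_nonneg_eq_0_iff) auto
  then have "S ** ?C = 0"
    using positive_semidefinite_null[OF S]
    by (auto simp: matrix_eq_0_columns column_matrix_mult)
  then show "S ** P = S" by (simp add: matrix_diff_ldistrib)
qed

section \<open>Rank-one matrices and reflections\<close>

definition outer_product :: "real^'m \<Rightarrow> real^'n \<Rightarrow> real^'n^'m" where
  "outer_product b a = (\<chi> i j. b $ i * a $ j)"

lemma outer_product_mult: "outer_product b a *v x = (a \<bullet> x) *\<^sub>R b"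
  by (simp add: outer_product_def matrix_vector_mult_def vec_eq_iff inner_vec_def
      sum_distrib_left sum_distrib_right mult_ac)

lemma inner_outer_product: "S \<bullet> outer_product b a = b \<bullet> (S *v a)"
  by (simp add: outer_product_def matrix_vector_mult_def inner_vec_def sum_distrib_left mult_ac)

lemma norm_outer_product: "norm (outer_product a b) = norm a * norm b"
proof -
  have "outer_product a b \<bullet> outer_product a b = (a \<bullet> a) * (b \<bullet> b)"
    by (simp add: inner_outer_product outer_product_mult)
  then show ?thesis by (simp add: norm_eq_sqrt_inner real_sqrt_mult)
qed

text \<open>The form is the Frobenius pairing of \<open>A\<close> with a rank-one matrix, so
  Cauchy-Schwarz applies.\<close>

lemma quadratic_form_bound: "\<bar>x \<bullet> (A *v x)\<bar> \<le> norm A * (norm x)\<^sup>2" for A :: "real^'n^'n"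
  using Cauchy_Schwarz_ineq2[of A "outer_product x x"]
  by (simp add: inner_outer_product norm_outer_product power2_eq_square)

text \<open>The reflection that sends \<open>v\<close> to \<open>- v\<close>. For
  \<open>v = 0\<close> division by zero yields the identity, so
  \<open>orthogonal_householder\<close> holds for every \<open>v\<close>.\<close>

definition householder :: "real^'n \<Rightarrow> real^'n^'n" where
  "householder v = mat 1 - (2 / (v \<bullet> v)) *\<^sub>R outer_product v v"

lemma householder_mult: "householder v *v x = x - (2 * (v \<bullet> x) / (v \<bullet> v)) *\<^sub>R v"
  by (simp add: householder_def matrix_vector_mult_diff_rdistrib outer_product_mult
      scaleR_matrix_vector_assoc[symmetric])

lemma transpose_householder: "transpose (householder v) = householder v"
  by (simp add: householder_def transpose_def outer_product_def mat_def vec_eq_iff mult_ac)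

lemma orthogonal_householder: "orthogonal_matrix (householder v)"
proof -
  have "householder v *v (householder v *v x) = x" for x
    by (cases "v = 0") (simp_all add: householder_mult inner_diff_right scaleR_add_left[symmetric])
  then have "householder v ** householder v = mat 1"
    by (simp add: matrix_eq matrix_vector_mul_assoc[symmetric])
  then show ?thesis by (simp add: orthogonal_matrix transpose_householder)
qed

text \<open>Products of two reflections approximate the infinitesimal rotations, which detect asymmetry.\<close>

lemma positive_semidefinite_if_maximal:
  fixes S :: "real^'n^'n"
  assumes max: "\<And>Q. orthogonal_matrix Q \<Longrightarrow> S \<bullet> Q \<le> S \<bullet> mat 1"
  shows "positive_semidefinite S"
proof -
  \<comment> \<open>A single reflection as competitor lowers the pairing by
    \<open>2 * (v \<bullet> (S *v v)) / (v \<bullet> v)\<close>, which maximality forces to be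
    nonnegative.\<close>
  have nonneg: "0 \<le> v \<bullet> (S *v v)" for v
  proof (cases "v = 0")
    case False
    have "S \<bullet> householder v = S \<bullet> mat 1 - (2 / (v \<bullet> v)) * (v \<bullet> (S *v v))"
      by (simp add: inner_diff_right inner_outer_product householder_def)
    with max[OF orthogonal_householder[of v]] False show ?thesis
      by (simp add: zero_le_divide_iff zero_le_mult_iff inner_gt_zero_iff[of v, symmetric] del: inner_gt_zero_iff)
  qed simp
  \<comment> \<open>The reflections in \<open>v\<close> and in \<open>w = v + t z\<close> compose to
    a rotation of the plane of \<open>v\<close> and \<open>z\<close> by an angle of order
    \<open>t\<close>. Maximality then gives a polynomial inequality in \<open>t\<close> whose linear
    coefficient is the asymmetry of \<open>S\<close> on that plane.\<close>
  have "z \<bullet> (S *v v) = v \<bullet> (S *v z)" if vz: "v \<bullet> v = 1" "z \<bullet> z = 1" "v \<bullet> z = 0" for v z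
  proof -
    have "0 \<le> t\<^sup>2 * (v \<bullet> (S *v v) + z \<bullet> (S *v z)) + t * (z \<bullet> (S *v v) - v \<bullet> (S *v z))" for t
    proof -
      define w where "w = v + t *\<^sub>R z"
      have w: "w \<bullet> w = 1 + t\<^sup>2" "v \<bullet> w = 1" "w \<bullet> v = 1"
        using vz by (auto simp: w_def inner_add_left inner_add_right power2_eq_square inner_commute)
      have pos: "1 + t\<^sup>2 > 0" by (intro add_pos_nonneg) auto
      have "householder v ** householder w = mat 1 - 2 *\<^sub>R outer_product v v
          - (2 / (1 + t\<^sup>2)) *\<^sub>R outer_product w w
          + (4 / (1 + t\<^sup>2)) *\<^sub>R outer_product v w"
        by (simp add: matrix_eq householder_mult matrix_vector_mult_diff_rdistrib
          matrix_vector_mult_add_rdistrib matrix_vector_mul_assoc[symmetric] inner_diff_right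
          scaleR_matrix_vector_assoc[symmetric] outer_product_mult w vz(1) scaleR_right_diff_distrib
          scaleR_left_diff_distrib diff_divide_distrib)
      then have "S \<bullet> (householder v ** householder w) = S \<bullet> mat 1 - 2 * (v \<bullet> (S *v v))
          - 2 / (1 + t\<^sup>2) * (w \<bullet> (S *v w)) + 4 / (1 + t\<^sup>2) * (v \<bullet> (S *v w))"
        by (simp add: inner_diff_right inner_add_right inner_outer_product)
      moreover have "S \<bullet> (householder v ** householder w) \<le> S \<bullet> mat 1"
        by (intro max orthogonal_matrix_mul orthogonal_householder)
      ultimately have "0 \<le> (v \<bullet> (S *v v)) + (w \<bullet> (S *v w)) / (1 + t\<^sup>2) - 2 * (v \<bullet> (S *v w)) / (1 + t\<^sup>2)"
        by simp
      then have "0 \<le> (1 + t\<^sup>2) * ((v \<bullet> (S *v v)) + (w \<bullet> (S *v w)) / (1 + t\<^sup>2) - 2 * (v \<bullet> (S *v w)) / (1 + t\<^sup>2))"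
        using pos by (intro mult_nonneg_nonneg) auto
      also have "\<dots> = (1 + t\<^sup>2) * (v \<bullet> (S *v v)) + w \<bullet> (S *v w) - 2 * (v \<bullet> (S *v w))"
        using pos by (simp add: distrib_left right_diff_distrib)
      also have "\<dots> = t\<^sup>2 * (v \<bullet> (S *v v) + z \<bullet> (S *v z)) + t * (z \<bullet> (S *v v) - v \<bullet> (S *v z))"
        by (simp add: w_def matrix_vector_right_distrib matrix_vector_mult_scaleR inner_add_left
            inner_add_right algebra_simps power2_eq_square)
      finally show ?thesis .
    qed
    from quadratic_coefficient_eq_0[OF this] show ?thesis by simp
  qed
  note swap = this
  have "S $ i $ j = S $ j $ i" if "i \<noteq> j" for i j
  proof -
    have "axis i (1::real) $ j = 0" using that by (simp add: axis_def)
    with swap[of "axis j 1" "axis i 1"] show ?thesis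
      by (simp add: inner_axis_axis inner_axis' matrix_vector_mult_basis column_def)
  qed
  then have "symmetric_matrix S"
    by (simp add: symmetric_matrix_def transpose_def vec_eq_iff) metis
  with nonneg show ?thesis by (simp add: positive_semidefinite_def)
qed

section \<open>Rank and null space\<close>

lemma rank_plus_nullity: "rank A + dim {x. A *v x = 0} = CARD('n)" for A :: "real^'n^'m"
proof -
  have "{x. A *v x = 0} = {y \<in> UNIV. \<forall>x \<in> span (rows A). orthogonal x y}"
  proof (intro equalityI subsetI CollectI conjI ballI UNIV_I; clarsimp)
    fix x y assume "A *v y = 0" "x \<in> span (rows A)"
    then show "orthogonal x y"
      by (metis orthogonal_nullspace_rowspace orthogonal_commute)
  next
    fix y assume *: "\<forall>x\<in>span (rows A). orthogonal x y"
    have "row i A \<bullet> y = 0" for i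
      using * by (auto simp: orthogonal_def rows_def intro: span_base)
    then show "A *v y = 0"
      by (simp add: vec_eq_iff matrix_vector_mult_def row_def inner_vec_def)
  qed
  moreover have "dim {y \<in> UNIV. \<forall>x \<in> span (rows A). orthogonal x y} + dim (span (rows A))
      = dim (UNIV :: (real^'n) set)"
    by (rule dim_subspace_orthogonal_to_vectors) (auto simp: dim_UNIV)
  ultimately show ?thesis by (simp add: row_rank_def)
qed

text \<open>Equal ranks mean equal nullities, and nested subspaces of equal dimension
  coincide.\<close>

lemma rank_eq_iff_null_space_eq:
  fixes A B :: "real^'n^'n"
  assumes sub: "{x. A *v x = 0} \<subseteq> {x. B *v x = 0}"
  shows "rank A = rank B \<longleftrightarrow> {x. A *v x = 0} = {x. B *v x = 0}"
proof -
  have sub': "subspace {x. C *v x = 0}" for C :: "real^'n^'n"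
    by (simp add: subspace_def matrix_vector_right_distrib matrix_vector_mult_scaleR)
  have "rank A = rank B \<longleftrightarrow> dim {x. A *v x = 0} = dim {x. B *v x = 0}"
    using rank_plus_nullity[of A] rank_plus_nullity[of B] by linarith
  also have "\<dots> \<longleftrightarrow> {x. A *v x = 0} = {x. B *v x = 0}"
    using subspace_dim_equal[OF sub' sub' sub] by auto
  finally show ?thesis .
qed

section \<open>Definiteness of combinations and coercivity\<close>

lemma positive_semidefinite_add:
  "positive_semidefinite A \<Longrightarrow> positive_semidefinite B \<Longrightarrow> positive_semidefinite (A + B)"
  by (auto simp: positive_semidefinite_def symmetric_matrix_def transpose_def vec_eq_iff
      matrix_vector_mult_add_rdistrib inner_add_right)

lemma positive_semidefinite_scaleR:
  "positive_semidefinite A \<Longrightarrow> 0 \<le> c \<Longrightarrow> positive_semidefinite (c *\<^sub>R A)"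
  by (auto simp: positive_semidefinite_def symmetric_matrix_def transpose_def vec_eq_iff
      simp flip: scaleR_matrix_vector_assoc)

lemma positive_definite_add_semidefinite:
  assumes "positive_definite A" "positive_semidefinite B" "0 < c" "0 \<le> b"
  shows "positive_definite (c *\<^sub>R A + b *\<^sub>R B)"
  using assms
  by (auto simp: positive_definite_def positive_semidefinite_def symmetric_matrix_def transpose_def
      vec_eq_iff matrix_vector_mult_add_rdistrib inner_add_right add_pos_nonneg
      simp flip: scaleR_matrix_vector_assoc)

lemma positive_definite_mult_cancel:
  fixes S A B :: "real^'n^'n"
  assumes "positive_definite S" "S ** A = S ** B"
  shows "A = B"
proof -
  have "S ** (A - B) = 0" using assms by (simp add: matrix_diff_ldistrib)
  then have "S *v column j (A - B) = 0" for j
    by (metis column_matrix_mult matrix_eq_0_columns)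
  then have "column j (A - B) = 0" for j
    using assms(1) by (metis inner_zero_right less_irrefl positive_definite_def)
  then have "A - B = 0" by (simp add: matrix_eq_0_columns del: right_minus_eq)
  then show ?thesis by simp
qed

text \<open>The constant is the minimum of the form on the compact unit sphere; homogeneity extends
  the bound to all vectors.\<close>

lemma positive_definite_coercive:
  fixes A :: "real^'n^'n"
  assumes "positive_definite A"
  shows "\<exists>c>0. \<forall>x. c * (norm x)\<^sup>2 \<le> x \<bullet> (A *v x)"
proof -
  have "continuous_on (sphere 0 1) (\<lambda>x. x \<bullet> (A *v x))"
    by (intro continuous_intros matrix_vector_mult_linear_continuous_on)
  moreover have "axis undefined 1 \<in> (sphere 0 1 :: (real^'n) set)" by simp
  then have "sphere 0 1 \<noteq> ({} :: (real^'n) set)" by blast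
  ultimately obtain z where "z \<in> sphere 0 1" "\<forall>x\<in>sphere 0 1. z \<bullet> (A *v z) \<le> x \<bullet> (A *v x)"
    using continuous_attains_inf[OF compact_sphere] by blast
  then have z: "norm z = 1" "\<And>x. norm x = 1 \<Longrightarrow> z \<bullet> (A *v z) \<le> x \<bullet> (A *v x)"
    by auto
  have "z \<noteq> 0" using z(1) by auto
  then have "0 < z \<bullet> (A *v z)"
    using assms by (simp add: positive_definite_def)
  moreover have "z \<bullet> (A *v z) * (norm x)\<^sup>2 \<le> x \<bullet> (A *v x)" for x
  proof (cases "x = 0")
    case False
    then have "z \<bullet> (A *v z) \<le> sgn x \<bullet> (A *v sgn x)"
      by (intro z(2)) (simp add: norm_sgn)
    also have "\<dots> = (x \<bullet> (A *v x)) / (norm x)\<^sup>2"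
      by (simp add: sgn_div_norm matrix_vector_mult_scaleR power2_eq_square field_simps)
    finally show ?thesis using False by (simp add: pos_le_divide_eq)
  qed simp
  ultimately show ?thesis by blast
qed

text \<open>A quantitative form of \<open>positive_semidefinite_inner_orthogonal\<close>, obtained
  by summing the coercivity bound over the columns of \<open>mat 1 - P\<close>. It penalises optimal
  matrices that stray from the identity.\<close>

lemma inner_orthogonal_coercive:
  fixes S P :: "real^'n^'n"
  assumes "symmetric_matrix S" "orthogonal_matrix P" "\<And>x. c * (norm x)\<^sup>2 \<le> x \<bullet> (S *v x)"
  shows "c / 2 * (norm (mat 1 - P))\<^sup>2 \<le> S \<bullet> (mat 1 - P)"
proof -
  let ?C = "mat 1 - P"
  have "c * (norm ?C)\<^sup>2 = (\<Sum>j\<in>UNIV. c * (norm (column j ?C))\<^sup>2)"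
    by (simp only: power2_norm_eq_inner inner_matrix_columns[of ?C ?C] sum_distrib_left)
  also have "\<dots> \<le> (\<Sum>j\<in>UNIV. column j ?C \<bullet> (S *v column j ?C))"
    by (intro sum_mono assms)
  also have "\<dots> = 2 * (S \<bullet> ?C)"
    using symmetric_inner_orthogonal[OF assms(1,2)] by (simp only: inner_conjugate_columns)
  finally show ?thesis by simp
qed

lemma gram_null_space: "(transpose C ** C) *v x = 0 \<longleftrightarrow> C *v x = 0" for C :: "real^'n^'m"
proof
  assume "(transpose C ** C) *v x = 0"
  then have "(C *v x) \<bullet> (C *v x) = 0"
    by (simp add: matrix_vector_inner matrix_vector_mul_assoc)
  then show "C *v x = 0" by simp
qed (simp flip: matrix_vector_mul_assoc)

text \<open>Multiplication cannot raise the rank, and the one-sided inverses recover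
  \<open>A\<close> from the product.\<close>

lemma rank_mult_invertible:
  fixes A U :: "real^'n^'n"
  assumes "U ** W = mat 1" "W' ** U' = mat 1"
  shows "rank (U' ** (A ** U)) = rank A"
proof (rule order_antisym)
  show "rank (U' ** (A ** U)) \<le> rank A"
    by (meson order_trans rank_mul_le_left rank_mul_le_right)
  have "A = W' ** (U' ** (A ** U)) ** W"
    by (metis assms matrix_mul_assoc matrix_mul_lid matrix_mul_rid)
  then show "rank A \<le> rank (U' ** (A ** U))"
    by (metis order_trans rank_mul_le_left rank_mul_le_right)
qed

section \<open>Alignment\<close>

lemma block_add: "block (A + B) s t = block A s t + block B s t"
  and block_scaleR: "block (c *\<^sub>R A) s t = c *\<^sub>R block A s t"
  and block_transpose: "block (transpose A) s t = transpose (block A t s)"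
  by (simp_all add: block_def vec_eq_iff transpose_def)

lemma sum_UNIV_prod: "(\<Sum>p\<in>UNIV. f p) = (\<Sum>t\<in>UNIV. \<Sum>i\<in>UNIV. f (t, i))"
  for f :: "'t::finite \<times> 'd::finite \<Rightarrow> 'b::comm_monoid_add"
  by (simp add: sum.cartesian_product)

lemma block_mult_block_diag: "block (K ** block_diag F) s t = block K s t ** F t"
proof -
  have "(\<Sum>q\<in>UNIV. K $ (s, i) $ q * block_diag F $ q $ (t, j))
      = (\<Sum>r\<in>UNIV. if r = t then \<Sum>k\<in>UNIV. K $ (s, i) $ (t, k) * F t $ k $ j else 0)" for i j
    unfolding sum_UNIV_prod by (intro sum.cong) (auto simp: block_diag_def)
  then show ?thesis
    by (simp add: block_def matrix_matrix_mult_def vec_eq_iff)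
qed

lemma inner_block_diag: "K \<bullet> block_diag F = (\<Sum>t\<in>UNIV. block K t t \<bullet> F t)"
proof -
  have "K \<bullet> block_diag F = (\<Sum>t\<in>UNIV. \<Sum>i\<in>UNIV. \<Sum>s\<in>UNIV. \<Sum>j\<in>UNIV.
      K $ (t, i) $ (s, j) * block_diag F $ (t, i) $ (s, j))"
    by (simp add: inner_vec_def sum_UNIV_prod)
  also have "\<dots> = (\<Sum>t\<in>UNIV. \<Sum>i\<in>UNIV. \<Sum>s\<in>UNIV.
      if s = t then \<Sum>j\<in>UNIV. K $ (t, i) $ (t, j) * F t $ i $ j else 0)"
    by (intro sum.cong) (auto simp: block_diag_def)
  finally show ?thesis by (simp add: inner_vec_def block_def)
qed

lemma block_orth_mult: "P ** Q \<in> block_orth" if "P \<in> block_orth" "Q \<in> block_orth"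
  using that unfolding block_orth_def by (auto simp: block_diag_mult orthogonal_matrix_mul)

lemma block_orthD:
  assumes "P \<in> block_orth"
  shows "transpose P \<in> block_orth" "P ** transpose P = mat 1" "transpose P ** P = mat 1"
    and "orthogonal_matrix (block P t t)" "block_diag (\<lambda>t. block P t t) = P"
proof -
  obtain F where F: "P = block_diag F" "\<And>t. orthogonal_matrix (F t)"
    using assms by (auto simp: block_orth_def)
  have B: "block (block_diag F) t t = F t" for t
    by (simp add: block_def block_diag_def vec_eq_iff)
  show "transpose P \<in> block_orth"
    using F by (auto simp: block_orth_def transpose_block_diag)
  show "P ** transpose P = mat 1" "transpose P ** P = mat 1"
    using F by (auto simp: transpose_block_diag block_diag_mult orthogonal_matrix_def block_diag_one)
  show "orthogonal_matrix (block P t t)" "block_diag (\<lambda>t. block P t t) = P"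
    using F by (auto simp: B)
qed

lemma block_diag_in_block_orth: "block_diag F \<in> block_orth" if "\<And>t. orthogonal_matrix (F t)"
  using that by (auto simp: block_orth_def)

lemma block_mult_block_orth:
  "P \<in> block_orth \<Longrightarrow> block (K ** P) s t = block K s t ** block P t t"
  using block_mult_block_diag[of K "\<lambda>t. block P t t" s t] by (simp add: block_orthD(5))

lemma inner_block_orth:
  "P \<in> block_orth \<Longrightarrow> K \<bullet> P = (\<Sum>t\<in>UNIV. block K t t \<bullet> block P t t)"
  using inner_block_diag[of K "\<lambda>t. block P t t"] by (simp add: block_orthD(5))

lemma inner_mat_1_blocks: "K \<bullet> mat 1 = (\<Sum>t\<in>UNIV. block K t t \<bullet> mat 1)"
  using inner_block_diag[of K "\<lambda>t. mat 1"] by (simp add: block_diag_one)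

lemma block_orth_cancel: "P \<in> block_orth \<Longrightarrow> A ** P ** transpose P = A"
  "P \<in> block_orth \<Longrightarrow> A ** transpose P ** P = A"
  by (simp_all add: block_orthD flip: matrix_mul_assoc)

lemma norm_mult_block_orth: "P \<in> block_orth \<Longrightarrow> norm (A ** P) = norm A"
  by (simp add: norm_eq_sqrt_inner inner_matrix_mult_right block_orth_cancel)

lemma block_lower_mult_orth: "L ** P \<in> block_lower" if "L \<in> block_lower" "P \<in> block_orth"
  using that by (auto simp: block_lower_def block_mult_block_orth)

lemma block_zero [simp]: "block 0 s t = 0"
  by (simp add: block_def vec_eq_iff)

lemma subspace_block_lower: "subspace block_lower"
  by (auto simp: subspace_def block_lower_def block_add block_scaleR)

text \<open>Optimality of \<open>mat 1\<close> is expressed through the diagonal blocks, because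
  positive semidefiniteness passes to nonnegative combinations; \<open>aligned_iff\<close> shows
  that the two notions agree.\<close>

definition aligned :: "('t::finite, 'd::finite) bmat \<Rightarrow> ('t, 'd) bmat \<Rightarrow> bool" where
  "aligned L N \<longleftrightarrow> (\<forall>t. positive_semidefinite (block (transpose N ** L) t t))"

text \<open>Since \<open>P\<close> preserves the norm of \<open>N\<close>, only the cross term
  depends on \<open>P\<close>: minimising the distance is maximising a linear functional of
  \<open>P\<close>.\<close>

lemma norm_diff_orth_squared:
  assumes "P \<in> block_orth"
  shows "(norm (L - N ** P))\<^sup>2 = (norm L)\<^sup>2 + (norm N)\<^sup>2 - 2 * ((transpose N ** L) \<bullet> P)"
proof -
  have "(norm (L - N ** P))\<^sup>2 = (norm L)\<^sup>2 + (norm (N ** P))\<^sup>2 - 2 * (L \<bullet> (N ** P))"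
    by (simp add: power2_norm_eq_inner inner_diff_left inner_diff_right inner_commute)
  also have "L \<bullet> (N ** P) = (transpose N ** L) \<bullet> P"
    by (metis inner_commute inner_matrix_mult_left)
  finally show ?thesis by (simp add: norm_mult_block_orth assms)
qed

lemma abw_dist_le: "P \<in> block_orth \<Longrightarrow> abw_dist L N \<le> norm (L - N ** P)"
  unfolding abw_dist_def by (rule cINF_lower) (auto intro!: bdd_belowI[of _ 0])

lemma abw_dist_le_norm: "abw_dist L N \<le> norm (L - N)"
  using abw_dist_le[OF mat_1_in_block_orth, of L N] by simp

lemma abw_dist_nonneg: "0 \<le> abw_dist L N"
  by (metis abw_dist_attained norm_ge_zero)

lemma abw_dist_eq_norm_iff:
  "abw_dist L N = norm (L - N) \<longleftrightarrow>
     (\<forall>P\<in>block_orth. (transpose N ** L) \<bullet> P \<le> (transpose N ** L) \<bullet> mat 1)"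
proof -
  have "abw_dist L N = norm (L - N) \<longleftrightarrow> (\<forall>P\<in>block_orth. norm (L - N) \<le> norm (L - N ** P))"
    by (metis abw_dist_attained abw_dist_le abw_dist_le_norm order_antisym)
  also have "\<dots> \<longleftrightarrow> (\<forall>P\<in>block_orth. (norm (L - N ** mat 1))\<^sup>2 \<le> (norm (L - N ** P))\<^sup>2)"
    by simp
  also have "\<dots> \<longleftrightarrow> (\<forall>P\<in>block_orth. (transpose N ** L) \<bullet> P \<le> (transpose N ** L) \<bullet> mat 1)"
    by (simp add: norm_diff_orth_squared mat_1_in_block_orth del: matrix_mul_rid power2_le_iff_abs_le power_mono_iff)
  finally show ?thesis .
qed

lemma aligned_iff:
  fixes L N :: "('t::finite, 'd::finite) bmat"
  shows "aligned L N \<longleftrightarrow> abw_dist L N = norm (L - N)"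
proof
  let ?K = "\<lambda>t. block (transpose N ** L) t t"
  show "abw_dist L N = norm (L - N)" if "aligned L N"
    unfolding abw_dist_eq_norm_iff
    using that by (auto simp: inner_block_orth inner_mat_1_blocks aligned_def block_orthD(4)
        intro!: sum_mono positive_semidefinite_inner_orthogonal)
  assume *: "abw_dist L N = norm (L - N)"
  show "aligned L N"
    unfolding aligned_def
  proof (intro allI positive_semidefinite_if_maximal)
    fix t and Q :: "real^'d^'d" assume Q: "orthogonal_matrix Q"
    \<comment> \<open>The competitor differs from the identity in block \<open>t\<close> only, so
      the inequality between the sums reduces to that block.\<close>
    let ?F = "(\<lambda>_. mat 1)(t := Q) :: 't \<Rightarrow> real^'d^'d"
    have "(transpose N ** L) \<bullet> block_diag ?F \<le> (transpose N ** L) \<bullet> mat 1"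
      using * Q by (auto simp: abw_dist_eq_norm_iff orthogonal_matrix_id intro!: block_diag_in_block_orth)
    then have "(\<Sum>s\<in>UNIV. ?K s \<bullet> ?F s) \<le> (\<Sum>s\<in>UNIV. ?K s \<bullet> mat 1)"
      by (simp add: inner_block_diag inner_mat_1_blocks)
    moreover have "(\<Sum>s\<in>UNIV. ?K s \<bullet> ?F s) = ?K t \<bullet> Q + (\<Sum>s\<in>UNIV - {t}. ?K s \<bullet> mat 1)"
      by (subst sum.remove[of UNIV t]) auto
    moreover have "(\<Sum>s\<in>UNIV. ?K s \<bullet> mat 1) = ?K t \<bullet> mat 1 + (\<Sum>s\<in>UNIV - {t}. ?K s \<bullet> mat 1)"
      by (rule sum.remove) auto
    ultimately show "?K t \<bullet> Q \<le> ?K t \<bullet> mat 1" by linarith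
  qed
qed

text \<open>Both \<open>N\<close> and \<open>N ** P\<close> realise the distance, so the pairings
  with \<open>P\<close> and with the identity agree. The blockwise inequalities add up to an
  equality, hence each of them is one, and the equality case applies.\<close>

lemma aligned_mult_orthD:
  assumes "aligned L N" and P: "P \<in> block_orth" and "aligned L (N ** P)"
  shows "block (transpose N ** L) t t ** block P t t = block (transpose N ** L) t t"
proof -
  let ?K = "\<lambda>t. block (transpose N ** L) t t"
  have psd: "positive_semidefinite (?K s)" for s
    using assms by (auto simp: aligned_def)
  have "norm (L - N ** P) = norm (L - N)"
    using assms by (metis P abw_dist_le aligned_iff abw_dist_le_norm block_orthD(1) block_orth_cancel(1) order_antisym)
  then have "(norm (L - N ** P))\<^sup>2 = (norm (L - N ** mat 1))\<^sup>2"
    by simp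
  then have "(transpose N ** L) \<bullet> P = (transpose N ** L) \<bullet> mat 1"
    by (simp add: norm_diff_orth_squared mat_1_in_block_orth P del: matrix_mul_rid)
  then have "(\<Sum>s\<in>UNIV. ?K s \<bullet> block P s s) = (\<Sum>s\<in>UNIV. ?K s \<bullet> mat 1)"
    by (simp add: inner_block_orth[OF P] inner_mat_1_blocks)
  then have "?K t \<bullet> block P t t = ?K t \<bullet> mat 1"
    using positive_semidefinite_inner_orthogonal(1)[OF psd block_orthD(4)[OF P]]
      sum_mono_inv[of "\<lambda>s. ?K s \<bullet> block P s s" UNIV "\<lambda>s. ?K s \<bullet> mat 1" t] by auto
  then show ?thesis
    by (rule positive_semidefinite_inner_orthogonal(2)[OF psd block_orthD(4)[OF P]])
qed

section \<open>Invariance and symmetry of the distance\<close>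

lemma abw_dist_mult_orth_right: "abw_dist L (M ** Q) = abw_dist L M" if "Q \<in> block_orth"
proof -
  have le: "abw_dist L N \<le> abw_dist L (N ** R)" if R: "R \<in> block_orth" for N R
  proof -
    obtain P where "P \<in> block_orth" "norm (L - N ** R ** P) = abw_dist L (N ** R)"
      using abw_dist_attained by blast
    then show ?thesis
      using abw_dist_le[OF block_orth_mult[OF R], of P L N] by (simp add: matrix_mul_assoc)
  qed
  show ?thesis
    using le[of Q M] le[of "transpose Q" "M ** Q"] that
    by (simp add: block_orthD(1) block_orth_cancel(1))
qed

lemma abw_dist_commute: "abw_dist L M = abw_dist M L"
proof -
  have "abw_dist A B \<le> abw_dist B A" for A B :: "('a, 'b) bmat"
  proof -
    obtain P where P: "P \<in> block_orth" "norm (B - A ** P) = abw_dist B A"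
      using abw_dist_attained by blast
    have "B - A ** P = (B ** transpose P - A) ** P"
      by (simp add: matrix_diff_rdistrib block_orth_cancel P)
    with P show ?thesis
      by (metis abw_dist_le block_orthD(1) norm_minus_commute norm_mult_block_orth)
  qed
  then show ?thesis by (metis order_antisym)
qed

lemma abw_dist_mult_orth_left: "abw_dist (L ** Q) M = abw_dist L M" if "Q \<in> block_orth"
  by (metis abw_dist_commute abw_dist_mult_orth_right that)

lemma abw_opt_iff: "P \<in> abw_opt L M \<longleftrightarrow> P \<in> block_orth \<and> aligned L (M ** P)"
  by (auto simp: abw_opt_def aligned_iff abw_dist_mult_orth_right)

lemma abw_opt_nonempty: "abw_opt L M \<noteq> {}"
  using abw_dist_attained[of L M] by (auto simp: abw_opt_def)

section \<open>Geodesics\<close>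

lemma aligned_refl: "aligned L L"
  unfolding aligned_iff using abw_dist_nonneg[of L L] abw_dist_le_norm[of L L] by simp

lemma aligned_commute: "aligned L N \<longleftrightarrow> aligned N L"
  by (simp add: aligned_iff abw_dist_commute norm_minus_commute)

text \<open>Bilinear expansion after writing \<open>L + u *\<^sub>R V\<close> as the combination of
  \<open>L\<close> and \<open>L + V\<close> with weights \<open>1 - u\<close> and \<open>u\<close>.
  For parameters in \<open>{0..1}\<close> all four coefficients are nonnegative.\<close>

lemma block_interpolate:
  fixes L V :: "('t::finite, 'd::finite) bmat"
  shows "block (transpose (L + v *\<^sub>R V) ** (L + u *\<^sub>R V)) t t =
    ((1 - v) * (1 - u)) *\<^sub>R block (transpose L ** L) t t
    + ((1 - v) * u) *\<^sub>R block (transpose L ** (L + V)) t t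
    + (v * (1 - u)) *\<^sub>R block (transpose (L + V) ** L) t t
    + (v * u) *\<^sub>R block (transpose (L + V) ** (L + V)) t t"
  by (simp add: transpose_add matrix_mult_scaleR transpose_scalar matrix_add_ldistrib
      matrix_add_rdistrib block_add block_scaleR) (simp add: algebra_simps)

lemma aligned_interpolate:
  assumes "aligned L (L + V)" "u \<in> {0..1}" "v \<in> {0..1}"
  shows "aligned (L + u *\<^sub>R V) (L + v *\<^sub>R V)"
  unfolding aligned_def block_interpolate
  using assms aligned_refl[of L] aligned_refl[of "L + V"] aligned_commute[of L "L + V"]
  by (auto simp: aligned_def intro!: positive_semidefinite_add positive_semidefinite_scaleR)

text \<open>For \<open>u < 1\<close> the definite Gram block of \<open>L\<close> keeps the positive
  weight \<open>1 - u\<close>. At \<open>u = 1\<close> definiteness can be lost, which is why a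
  point inside a geodesic determines its direction while the endpoint may not.\<close>

lemma positive_definite_interpolate:
  assumes "positive_definite (block (transpose L ** L) t t)" "aligned L (L + V)" "0 \<le> u" "u < 1"
  shows "positive_definite (block (transpose (L + u *\<^sub>R V) ** L) t t)"
proof -
  have "block (transpose (L + u *\<^sub>R V) ** L) t t =
      (1 - u) *\<^sub>R block (transpose L ** L) t t + u *\<^sub>R block (transpose (L + V) ** L) t t"
    using block_interpolate[of L u V 0 t] by simp
  then show ?thesis
    using assms by (auto simp: aligned_def intro!: positive_definite_add_semidefinite)
qed

lemma block_orth_eqI:
  "P \<in> block_orth \<Longrightarrow> Q \<in> block_orth \<Longrightarrow> (\<And>t. block P t t = block Q t t) \<Longrightarrow> P = Q"
  by (metis (no_types, lifting) block_orthD(5) ext)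

text \<open>\<open>aligned_mult_orthD\<close> says that each block of \<open>P\<close> is fixed
  under multiplication by a definite matrix, which can be cancelled.\<close>

lemma aligned_unique:
  fixes L N :: "('t::finite, 'd::finite) bmat"
  assumes "aligned L N" "\<And>t. positive_definite (block (transpose N ** L) t t)"
    and P: "P \<in> block_orth" and "aligned L (N ** P)"
  shows "P = mat 1"
proof (rule block_orth_eqI[OF P mat_1_in_block_orth])
  fix t :: 't
  have one: "block (mat 1 :: ('t, 'd) bmat) t t = mat 1"
    by (simp add: block_def mat_def vec_eq_iff)
  have "block (transpose N ** L) t t ** block P t t = block (transpose N ** L) t t"
    by (rule aligned_mult_orthD) (use assms in auto)
  then show "block P t t = block (mat 1) t t"
    using positive_definite_mult_cancel[OF assms(2)] by (simp add: one)
qed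

section \<open>The quotient space\<close>

lemma abw_class_eq_iff:
  assumes "L \<in> block_lower" "M \<in> block_lower"
  shows "abw_class L = abw_class M \<longleftrightarrow> (\<exists>P\<in>block_orth. L = M ** P)"
  using eq_equiv_class_iff[OF equiv_abw_rel assms] assms
  by (simp add: abw_class_def abw_rel_def)

lemma abw_class_in_space: "L \<in> block_lower \<Longrightarrow> abw_class L \<in> abw_space"
  by (simp add: abw_class_def abw_space_def quotientI)

lemma abw_spaceE:
  assumes "X \<in> abw_space" obtains L where "L \<in> block_lower" "X = abw_class L"
  using assms unfolding abw_space_def by (auto elim!: quotientE simp: abw_class_def)

text \<open>Invariance in both arguments makes the set of values in \<open>lift_dist\<close> a
  singleton, so \<open>the_elem\<close> returns the expected number.\<close>

lemma abw_qdist_class: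
  assumes "L \<in> block_lower" "M \<in> block_lower"
  shows "abw_qdist (abw_class L) (abw_class M) = abw_dist L M"
proof -
  have "(\<lambda>(x, y). abw_dist x y) ` (abw_class L \<times> abw_class M) = {abw_dist L M}"
  proof (intro equalityI subsetI)
    fix r assume "r \<in> {abw_dist L M}"
    moreover have "L \<in> abw_class L" "M \<in> abw_class M"
      using assms equiv_class_self[OF equiv_abw_rel] by (auto simp: abw_class_def)
    ultimately show "r \<in> (\<lambda>(x, y). abw_dist x y) ` (abw_class L \<times> abw_class M)"
      by force
  qed (auto simp: abw_class_def abw_rel_def abw_dist_mult_orth_left abw_dist_mult_orth_right)
  then show ?thesis by (simp add: lift_dist_def)
qed

text \<open>An optimal \<open>P\<close> moves a given representative to one whose Frobenius distance
  from \<open>L\<close> is the quotient distance. Repeated use lifts successive points of a geodesic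
  to matrices.\<close>

lemma aligned_representative:
  assumes L: "L \<in> block_lower" and "X \<in> abw_space"
  obtains N where "N \<in> block_lower" "X = abw_class N" "norm (L - N) = abw_qdist (abw_class L) X"
proof -
  obtain M where M: "M \<in> block_lower" "X = abw_class M"
    using assms by (auto elim: abw_spaceE)
  obtain P where P: "P \<in> block_orth" "norm (L - M ** P) = abw_dist L M"
    using abw_dist_attained by blast
  have MP: "M ** P \<in> block_lower" using M P block_lower_mult_orth by blast
  then have "abw_class (M ** P) = X"
    using P M by (auto simp: abw_class_eq_iff)
  with that[OF MP] P M L show thesis by (simp add: abw_qdist_class)
qed

lemma abw_class_eq_iff_dist:
  assumes "L \<in> block_lower" "M \<in> block_lower"
  shows "abw_class L = abw_class M \<longleftrightarrow> abw_dist L M = 0"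
proof
  assume "abw_class L = abw_class M"
  then obtain P where "P \<in> block_orth" "L = M ** P" by (auto simp: abw_class_eq_iff[OF assms])
  then have "abw_dist L M \<le> 0" using abw_dist_le[of P L M] by simp
  then show "abw_dist L M = 0" using abw_dist_nonneg[of L M] by simp
next
  assume "abw_dist L M = 0"
  then show "abw_class L = abw_class M"
    using abw_dist_attained[of L M] by (auto simp: abw_class_eq_iff[OF assms])
qed

text \<open>The optimal \<open>P\<close> can be absorbed into \<open>M\<close>, so it may be taken
  to be the identity.\<close>

lemma opt_dirs_iff:
  assumes "L \<in> block_lower"
  shows "V \<in> opt_dirs L \<longleftrightarrow> V \<in> block_lower \<and> aligned L (L + V)"
proof
  assume "V \<in> opt_dirs L"
  then show "V \<in> block_lower \<and> aligned L (L + V)"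
    using assms by (auto simp: opt_dirs_def abw_opt_iff block_lower_mult_orth
        intro: subspace_diff[OF subspace_block_lower])
next
  assume "V \<in> block_lower \<and> aligned L (L + V)"
  then have "V = (L + V) ** mat 1 - L \<and> L + V \<in> block_lower \<and> mat 1 \<in> abw_opt L (L + V)"
    using assms by (auto simp: abw_opt_iff mat_1_in_block_orth intro: subspace_add[OF subspace_block_lower])
  then show "V \<in> opt_dirs L" unfolding opt_dirs_def by blast
qed

section \<open>Geodesics as projected segments\<close>

lemma block_lower_segment:
  "L \<in> block_lower \<Longrightarrow> V \<in> block_lower \<Longrightarrow> L + u *\<^sub>R V \<in> block_lower"
  by (intro subspace_add[OF subspace_block_lower] subspace_scale[OF subspace_block_lower])

definition segment_curve :: "('t::{finite,linorder}, 'd::finite) bmat \<Rightarrow> ('t, 'd) bmat \<Rightarrow> ('t, 'd) curve" where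
  "segment_curve L V = restrict (\<lambda>u. abw_class (L + u *\<^sub>R V)) {0..1}"

lemma abw_qdist_segment:
  assumes "L \<in> block_lower" "V \<in> opt_dirs L" "u \<in> {0..1}" "v \<in> {0..1}"
  shows "abw_qdist (abw_class (L + u *\<^sub>R V)) (abw_class (L + v *\<^sub>R V)) = \<bar>u - v\<bar> * norm V"
proof -
  have V: "V \<in> block_lower" "aligned L (L + V)"
    using assms by (auto simp: opt_dirs_iff)
  have "abw_qdist (abw_class (L + u *\<^sub>R V)) (abw_class (L + v *\<^sub>R V))
      = norm ((L + u *\<^sub>R V) - (L + v *\<^sub>R V))"
    using aligned_interpolate[OF V(2) assms(3,4)] assms V
    by (simp add: abw_qdist_class block_lower_segment aligned_iff)
  also have "\<dots> = norm ((u - v) *\<^sub>R V)" by (simp add: scaleR_left_diff_distrib)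
  finally show ?thesis by simp
qed

lemma segment_curve_geodesic:
  assumes "L \<in> block_lower" "V \<in> opt_dirs L"
  shows "segment_curve L V \<in> geodesics_from (abw_class L)"
proof -
  have "V \<in> block_lower" using assms by (simp add: opt_dirs_iff)
  then show ?thesis
    using assms abw_qdist_segment[OF assms, of 0 1]
    by (auto simp: geodesics_from_def segment_curve_def abw_qdist_segment
        intro!: abw_class_in_space block_lower_segment)
qed

text \<open>Both points are aligned with \<open>L\<close> and differ by some \<open>P\<close>.
  Strictly inside the segment the blocks are definite, so \<open>aligned_unique\<close> gives
  \<open>P = mat 1\<close>.\<close>

lemma abw_class_segment_inj:
  assumes L: "L \<in> block_lower_reg" and V: "V \<in> opt_dirs L" and W: "W \<in> opt_dirs L"
    and u: "0 < u" "u < 1" and eq: "abw_class (L + u *\<^sub>R V) = abw_class (L + u *\<^sub>R W)"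
  shows "V = W"
proof -
  have L': "L \<in> block_lower" "\<And>t. positive_definite (block (transpose L ** L) t t)"
    using L by (auto simp: block_lower_reg_def)
  have VW: "V \<in> block_lower" "aligned L (L + V)" "W \<in> block_lower" "aligned L (L + W)"
    using V W L' by (auto simp: opt_dirs_iff)
  obtain P where P: "P \<in> block_orth" "L + u *\<^sub>R V = (L + u *\<^sub>R W) ** P"
    using eq VW L' by (auto simp: abw_class_eq_iff block_lower_segment)
  have "aligned L (L + u *\<^sub>R V)" "aligned L (L + u *\<^sub>R W)"
    using aligned_interpolate[OF VW(2), of 0 u] aligned_interpolate[OF VW(4), of 0 u] u by auto
  then have "P = mat 1"
    using aligned_unique[of L "L + u *\<^sub>R W" P] P u positive_definite_interpolate[OF L'(2) VW(4)]
    by auto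
  with P u show ?thesis by simp
qed

text \<open>The equality case of the triangle inequality. Stewart's identity expresses the squared
  distance of \<open>z\<close> from the division point by the three side lengths, and the hypotheses
  make that expression at most \<open>0\<close>.\<close>

lemma between_point_unique:
  fixes x y z :: "'a::real_inner"
  assumes "0 \<le> u" "u \<le> 1" "0 \<le> d" "norm (z - x) \<le> u * d" "norm (y - z) \<le> (1 - u) * d" "d \<le> norm (y - x)"
  shows "z = x + u *\<^sub>R (y - x)"
proof -
  have "(norm (z - (x + u *\<^sub>R (y - x))))\<^sup>2 =
      (1 - u) * (norm (z - x))\<^sup>2 + u * (norm (y - z))\<^sup>2 - u * (1 - u) * (norm (y - x))\<^sup>2"
    unfolding power2_norm_eq_inner
    by (simp add: inner_add_left inner_add_right inner_diff_left inner_diff_right inner_commute algebra_simps)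
  also have "\<dots> \<le> (1 - u) * (u * d)\<^sup>2 + u * ((1 - u) * d)\<^sup>2 - u * (1 - u) * d\<^sup>2"
    using assms by (intro diff_mono add_mono mult_left_mono power_mono) auto
  also have "\<dots> = 0" by (simp add: power2_eq_square algebra_simps)
  finally show ?thesis by simp
qed

text \<open>Lift \<open>\<gamma> u\<close>, \<open>\<gamma> v\<close> and \<open>\<gamma> 1\<close>
  successively to \<open>Y\<close>, \<open>Z\<close> and \<open>N\<close>, each aligned with the one
  before. The broken line from \<open>L\<close> to \<open>N\<close> has length
  \<open>abw_dist L N\<close>, which is at most \<open>norm (L - N)\<close>, so it is straight and
  \<open>N\<close> is aligned with \<open>L\<close>. Two times are treated together because the
  direction found may depend on them.\<close>

lemma geodesic_two_points:
  assumes L: "L \<in> block_lower" and \<gamma>: "\<gamma> \<in> geodesics_from (abw_class L)"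
    and uv: "0 \<le> u" "u \<le> v" "v \<le> 1"
  shows "\<exists>W\<in>opt_dirs L. \<gamma> u = abw_class (L + u *\<^sub>R W) \<and> \<gamma> v = abw_class (L + v *\<^sub>R W) \<and>
    \<gamma> 1 = abw_class (L + W)"
proof -
  let ?d = "abw_qdist (\<gamma> 0) (\<gamma> 1)"
  have sp: "\<gamma> s \<in> abw_space" if "s \<in> {0..1}" for s
    using \<gamma> that by (auto simp: geodesics_from_def)
  have g0: "\<gamma> 0 = abw_class L"
    using \<gamma> by (simp add: geodesics_from_def)
  have dist: "abw_qdist (\<gamma> s) (\<gamma> r) = \<bar>s - r\<bar> * ?d" if "s \<in> {0..1}" "r \<in> {0..1}" for s r
    using \<gamma> that by (simp add: geodesics_from_def)
  obtain Y where Y: "Y \<in> block_lower" "\<gamma> u = abw_class Y" "norm (L - Y) = abw_qdist (abw_class L) (\<gamma> u)"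
    using aligned_representative[OF L sp[of u]] uv by auto
  obtain Z where Z: "Z \<in> block_lower" "\<gamma> v = abw_class Z" "norm (Y - Z) = abw_qdist (abw_class Y) (\<gamma> v)"
    using aligned_representative[OF Y(1) sp[of v]] uv by auto
  obtain N where N: "N \<in> block_lower" "\<gamma> 1 = abw_class N" "norm (Z - N) = abw_qdist (abw_class Z) (\<gamma> 1)"
    using aligned_representative[OF Z(1) sp[of 1]] by auto
  have n: "norm (L - Y) = u * ?d" "norm (Y - Z) = (v - u) * ?d" "norm (Z - N) = (1 - v) * ?d"
    using Y(3) Z(3) N(3) uv dist[of 0 u] dist[of u v] dist[of v 1] g0 Y(2) Z(2) by auto
  have d: "?d = abw_dist L N"
    using L N g0 by (simp add: abw_qdist_class)
  then have d0: "0 \<le> ?d" "?d \<le> norm (L - N)"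
    by (simp_all add: abw_dist_nonneg abw_dist_le_norm)
  have LZ: "norm (L - Z) \<le> v * ?d"
    using norm_triangle_ineq[of "L - Y" "Y - Z"] n by (simp add: algebra_simps)
  have YN: "norm (Y - N) \<le> (1 - u) * ?d"
    using norm_triangle_ineq[of "Y - Z" "Z - N"] n by (simp add: algebra_simps)
  have "Y = L + u *\<^sub>R (N - L)"
    using n(1) YN d0 uv by (intro between_point_unique[where d = ?d]) (auto simp: norm_minus_commute)
  moreover have "Z = L + v *\<^sub>R (N - L)"
    using n(3) LZ d0 uv by (intro between_point_unique[where d = ?d]) (auto simp: norm_minus_commute)
  moreover have "norm (L - N) \<le> ?d"
    using norm_triangle_ineq[of "L - Z" "Z - N"] n LZ by (simp add: algebra_simps)
  then have "aligned L N" using d d0 by (simp add: aligned_iff)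
  then have "N - L \<in> opt_dirs L"
    using L N by (simp add: opt_dirs_iff subspace_diff[OF subspace_block_lower])
  ultimately show ?thesis using Y Z N by (intro bexI[of _ "N - L"]) auto
qed

text \<open>
  The direction read off at time \<open>1/2\<close> is correct at all times, because a point of the open
  segment determines its direction.
\<close>

lemma geodesic_is_segment:
  assumes L: "L \<in> block_lower_reg" and \<gamma>: "\<gamma> \<in> geodesics_from (abw_class L)"
  shows "\<exists>V\<in>opt_dirs L. \<gamma> = segment_curve L V"
proof -
  have L': "L \<in> block_lower" using L by (simp add: block_lower_reg_def)
  obtain V where V: "V \<in> opt_dirs L" "\<gamma> (1/2) = abw_class (L + (1/2) *\<^sub>R V)"
    using geodesic_two_points[OF L' \<gamma>, of "1/2" "1/2"] by auto
  have "\<gamma> u = abw_class (L + u *\<^sub>R V)" if u: "u \<in> {0..1}" for u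
  proof -
    obtain W where W: "W \<in> opt_dirs L" "\<gamma> u = abw_class (L + u *\<^sub>R W)"
      "\<gamma> (1/2) = abw_class (L + (1/2) *\<^sub>R W)"
    \<comment> \<open>\<open>geodesic_two_points\<close> takes its times in increasing order, so
      \<open>u\<close> comes before or after \<open>1/2\<close>.\<close>
    proof (cases "u \<le> 1/2")
      case True
      then have "0 \<le> u" "u \<le> 1/2" "1/2 \<le> (1::real)" using u by auto
      from geodesic_two_points[OF L' \<gamma> this] show thesis
        by (elim bexE conjE) (rule that)
    next
      case False
      then have "0 \<le> (1/2::real)" "1/2 \<le> u" "u \<le> 1" using u by auto
      from geodesic_two_points[OF L' \<gamma> this] show thesis
        by (elim bexE conjE) (rule that)
    qed
    have "abw_class (L + (1/2) *\<^sub>R W) = abw_class (L + (1/2) *\<^sub>R V)"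
      using W(3)[symmetric] V(2) by (rule trans)
    then have "W = V"
      by (rule abw_class_segment_inj[OF L W(1) V(1), rotated 2]) auto
    with W show ?thesis by simp
  qed
  moreover have "\<gamma> \<in> extensional {0..1}"
    using \<gamma> by (auto simp: geodesics_from_def PiE_def)
  ultimately have "\<gamma> = segment_curve L V"
    by (auto simp: segment_curve_def fun_eq_iff extensional_def restrict_def)
  with V show ?thesis by blast
qed

lemma segment_curve_inj:
  assumes "L \<in> block_lower_reg" "V \<in> opt_dirs L" "W \<in> opt_dirs L" "segment_curve L V = segment_curve L W"
  shows "V = W"
  using abw_class_segment_inj[OF assms(1-3), of "1/2"] fun_cong[OF assms(4), of "1/2"]
  by (simp add: segment_curve_def)

lemma geodesics_between_eq:
  assumes L: "L \<in> block_lower_reg" and M: "M \<in> block_lower"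
  shows "geodesics_between (abw_class L) (abw_class M) =
    (\<lambda>P. segment_curve L (M ** P - L)) ` abw_opt L M"
proof (intro equalityI subsetI)
  have L': "L \<in> block_lower" using L by (simp add: block_lower_reg_def)
  fix \<gamma> assume "\<gamma> \<in> geodesics_between (abw_class L) (abw_class M)"
  then obtain V where V: "V \<in> opt_dirs L" "\<gamma> = segment_curve L V" "\<gamma> 1 = abw_class M"
    using geodesic_is_segment[OF L] by (auto simp: geodesics_between_def)
  then have V': "V \<in> block_lower" "aligned L (L + V)" using L' by (auto simp: opt_dirs_iff)
  then obtain P where P: "P \<in> block_orth" "L + V = M ** P"
    using V(2,3) L' M block_lower_segment[OF L', of V 1]
    by (auto simp: segment_curve_def abw_class_eq_iff)
  then have "P \<in> abw_opt L M" using V' by (simp add: abw_opt_iff)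
  moreover have "V = M ** P - L" by (simp flip: P(2))
  ultimately show "\<gamma> \<in> (\<lambda>P. segment_curve L (M ** P - L)) ` abw_opt L M"
    using V by blast
next
  have L': "L \<in> block_lower" using L by (simp add: block_lower_reg_def)
  fix \<gamma> assume "\<gamma> \<in> (\<lambda>P. segment_curve L (M ** P - L)) ` abw_opt L M"
  then obtain P where P: "P \<in> abw_opt L M" "\<gamma> = segment_curve L (M ** P - L)" by blast
  have "M ** P - L \<in> opt_dirs L" using P M by (auto simp: opt_dirs_def)
  moreover have "abw_class (M ** P) = abw_class M"
    using P M by (auto simp: abw_opt_iff abw_class_eq_iff block_lower_mult_orth)
  ultimately show "\<gamma> \<in> geodesics_between (abw_class L) (abw_class M)"
    using P segment_curve_geodesic[OF L'] by (simp add: geodesics_between_def segment_curve_def)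
qed

lemma ex1_image_iff: "A \<noteq> {} \<Longrightarrow> (\<exists>!y. y \<in> f ` A) \<longleftrightarrow> (\<forall>x\<in>A. \<forall>z\<in>A. f x = f z)"
  by (simp only: Ex1_def image_iff Bex_def ex_in_conv[symmetric] Ball_def) metis

text \<open>Distinct directions give distinct curves, so geodesics are counted by the products
  \<open>M ** P\<close>; different optimal \<open>P\<close> may share one.\<close>

lemma unique_geodesic_iff_opt:
  assumes L: "L \<in> block_lower_reg" and M: "M \<in> block_lower"
  shows "(\<exists>!\<gamma>. \<gamma> \<in> geodesics_between (abw_class L) (abw_class M)) \<longleftrightarrow>
    (\<forall>P\<in>abw_opt L M. \<forall>Q\<in>abw_opt L M. M ** P = M ** Q)"
proof -
  have "M ** P - L \<in> opt_dirs L" if "P \<in> abw_opt L M" for P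
    using M that by (auto simp: opt_dirs_def)
  then have inj: "segment_curve L (M ** P - L) = segment_curve L (M ** Q - L) \<longleftrightarrow> M ** P = M ** Q"
    if "P \<in> abw_opt L M" "Q \<in> abw_opt L M" for P Q
    using segment_curve_inj[OF L] that by fastforce
  have "(\<exists>!\<gamma>. \<gamma> \<in> geodesics_between (abw_class L) (abw_class M)) \<longleftrightarrow>
    (\<forall>P\<in>abw_opt L M. \<forall>Q\<in>abw_opt L M. segment_curve L (M ** P - L) = segment_curve L (M ** Q - L))"
    unfolding geodesics_between_eq[OF L M] by (rule ex1_image_iff[OF abw_opt_nonempty])
  also have "\<dots> \<longleftrightarrow> (\<forall>P\<in>abw_opt L M. \<forall>Q\<in>abw_opt L M. M ** P = M ** Q)"
    using inj by blast
  finally show ?thesis .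
qed

section \<open>The rank criterion\<close>

text \<open>These rectangular blocks factor the diagonal blocks of \<open>transpose N ** L\<close>,
  and block diagonal matrices act on them separately. The null space of a Gram block is that of its
  column block.\<close>

definition block_column :: "('t::finite, 'd::finite) bmat \<Rightarrow> 't \<Rightarrow> real^'d^('t \<times> 'd)" where
  "block_column A t = (\<chi> p j. A $ p $ (t, j))"

lemma block_transpose_mult:
  "block (transpose N ** L) s t = transpose (block_column N s) ** block_column L t"
  by (simp add: block_def block_column_def matrix_matrix_mult_def transpose_def vec_eq_iff)

lemma block_column_mult_block_diag:
  "block_column (M ** block_diag F) t = block_column M t ** F t"
proof -
  have "(\<Sum>q\<in>UNIV. M $ p $ q * block_diag F $ q $ (t, j))
      = (\<Sum>r\<in>UNIV. if r = t then \<Sum>k\<in>UNIV. M $ p $ (t, k) * F t $ k $ j else 0)" for p j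
    unfolding sum_UNIV_prod by (intro sum.cong) (auto simp: block_diag_def)
  then show ?thesis
    by (simp add: block_column_def matrix_matrix_mult_def vec_eq_iff)
qed

lemma block_column_mult_block_orth:
  "P \<in> block_orth \<Longrightarrow> block_column (M ** P) t = block_column M t ** block P t t"
  using block_column_mult_block_diag[of M "\<lambda>t. block P t t" t] by (simp add: block_orthD(5))

lemma block_columns_eqI: "(\<And>t. block_column A t = block_column B t) \<Longrightarrow> A = B"
  by (simp add: block_column_def vec_eq_iff)

text \<open>Neither rank in the criterion depends on the representative of the class of
  \<open>M\<close>, so \<open>M\<close> may be replaced by an aligned one.\<close>

lemma rank_mult_orth:
  fixes L M P :: "('t::finite, 'd::finite) bmat"
  assumes P: "P \<in> block_orth"
  shows "rank (block (transpose (M ** P) ** (M ** P)) t t) = rank (block (transpose M ** M) t t)"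
    and "rank (block (transpose (M ** P) ** L) t t) = rank (block (transpose M ** L) t t)"
proof -
  let ?p = "block P t t"
  have p: "?p ** transpose ?p = mat 1"
    using block_orthD(4)[OF P, of t] by (simp add: orthogonal_matrix_def)
  have "block (transpose (M ** P) ** (M ** P)) t t = transpose ?p ** (block (transpose M ** M) t t ** ?p)"
    unfolding block_transpose_mult block_column_mult_block_orth[OF P]
    by (simp only: matrix_transpose_mul matrix_mul_assoc)
  then show "rank (block (transpose (M ** P) ** (M ** P)) t t) = rank (block (transpose M ** M) t t)"
    using rank_mult_invertible[OF p p] by simp
  have "block (transpose (M ** P) ** L) t t = transpose ?p ** (block (transpose M ** L) t t ** mat 1)"
    unfolding block_transpose_mult block_column_mult_block_orth[OF P]
    by (simp only: matrix_transpose_mul matrix_mul_assoc matrix_mul_rid)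
  then show "rank (block (transpose (M ** P) ** L) t t) = rank (block (transpose M ** L) t t)"
    using rank_mult_invertible[OF matrix_mul_lid p] by (simp only:)
qed

text \<open>An orthogonal \<open>P\<close> that keeps alignment moves vectors only along the null
  spaces of the \<open>S\<close> blocks. It fixes \<open>N\<close> for every such \<open>P\<close>
  exactly when these null spaces lie in those of the column blocks of \<open>N\<close>. The reverse
  inclusion always holds, so the condition is equality of ranks.\<close>

lemma aligned_rank_iff:
  fixes L N :: "('t::finite, 'd::finite) bmat"
  assumes N: "aligned L N"
  shows "(\<forall>P\<in>block_orth. aligned L (N ** P) \<longrightarrow> N ** P = N) \<longleftrightarrow>
    (\<forall>t. rank (block (transpose N ** N) t t) = rank (block (transpose N ** L) t t))"
proof -
  let ?S = "\<lambda>t. block (transpose N ** L) t t" and ?G = "\<lambda>t. block (transpose N ** N) t t"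
  have psd: "positive_semidefinite (?S t)" for t
    using N by (simp add: aligned_def)
  have null: "?G t *v x = 0 \<longleftrightarrow> block_column N t *v x = 0" for t x
    by (simp add: block_transpose_mult gram_null_space)
  \<comment> \<open>Symmetry brings \<open>N\<close> to the right-hand factor, so vectors killed by
    the column block of \<open>N\<close> are killed by \<open>?S t\<close>.\<close>
  have "?S t = transpose (block_column L t) ** block_column N t" for t
    using psd[of t]
    by (simp add: positive_semidefinite_def symmetric_matrix_def block_transpose_mult matrix_transpose_mul)
  then have sub: "{x. ?G t *v x = 0} \<subseteq> {x. ?S t *v x = 0}" for t
    by (auto simp: null simp flip: matrix_vector_mul_assoc)
  have "(\<forall>P\<in>block_orth. aligned L (N ** P) \<longrightarrow> N ** P = N) \<longleftrightarrow>
    (\<forall>t. {x. ?S t *v x = 0} \<subseteq> {x. ?G t *v x = 0})"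
  proof safe
    fix t x
    assume *: "\<forall>P\<in>block_orth. aligned L (N ** P) \<longrightarrow> N ** P = N" and x: "?S t *v x = 0"
    \<comment> \<open>Reflecting a null vector \<open>x\<close> of \<open>?S t\<close> leaves
      \<open>?S t\<close>, and hence alignment, unchanged. Then \<open>N\<close> is fixed while
      \<open>x\<close> goes to \<open>- x\<close>, so the column block of \<open>N\<close> kills
      \<open>x\<close>.\<close>
    let ?F = "(\<lambda>_. mat 1)(t := householder x) :: 't \<Rightarrow> real^'d^'d"
    have F: "block_diag ?F \<in> block_orth"
      by (intro block_diag_in_block_orth) (simp add: orthogonal_householder orthogonal_matrix_id)
    have "householder x ** ?S t = ?S t"
    proof -
      have "?S t *v (householder x *v y) = ?S t *v y" for y
        using x by (simp add: householder_mult matrix_vector_mult_diff_distrib matrix_vector_mult_scaleR)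
      then have "?S t ** householder x = ?S t"
        by (simp add: matrix_eq flip: matrix_vector_mul_assoc)
      then have "transpose (?S t ** householder x) = transpose (?S t)" by simp
      then show ?thesis
        using psd[of t]
        by (simp add: matrix_transpose_mul transpose_householder positive_semidefinite_def symmetric_matrix_def)
    qed
    then have "block (transpose (N ** block_diag ?F) ** L) s s = ?S s" for s
      unfolding block_transpose_mult block_column_mult_block_diag
      by (simp add: matrix_transpose_mul transpose_householder flip: matrix_mul_assoc)
    then have "N ** block_diag ?F = N"
      using * F N by (simp add: aligned_def)
    then have "block_column N t ** householder x = block_column N t"
      using block_column_mult_block_diag[of N ?F t] by simp
    then have "block_column N t *v (householder x *v x) = block_column N t *v x"
      by (simp add: matrix_vector_mul_assoc)
    then show "?G t *v x = 0"
      by (cases "x = 0") (simp_all add: householder_mult null matrix_vector_mult_diff_distrib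
          matrix_vector_mult_scaleR)
  next
    fix P
    assume *: "\<forall>t. {x. ?S t *v x = 0} \<subseteq> {x. ?G t *v x = 0}" and P: "P \<in> block_orth" "aligned L (N ** P)"
    show "N ** P = N"
    proof (rule block_columns_eqI)
      fix t
      \<comment> \<open>The columns of this difference lie in the null space of \<open>?S t\<close>,
        hence by assumption in that of the column block of \<open>N\<close>.\<close>
      have "?S t ** (block P t t - mat 1) = 0"
        using aligned_mult_orthD[OF N P] by (simp add: matrix_diff_ldistrib)
      then have "?S t *v column j (block P t t - mat 1) = 0" for j
        by (metis column_matrix_mult matrix_eq_0_columns)
      then have "block_column N t *v column j (block P t t - mat 1) = 0" for j
        using * null by blast
      then have "block_column N t ** (block P t t - mat 1) = 0"
        by (simp add: matrix_eq_0_columns column_matrix_mult)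
      then show "block_column (N ** P) t = block_column N t"
        by (simp add: block_column_mult_block_orth P matrix_diff_ldistrib)
    qed
  qed
  also have "\<dots> \<longleftrightarrow> (\<forall>t. rank (?G t) = rank (?S t))"
    using rank_eq_iff_null_space_eq[OF sub] sub by blast
  finally show ?thesis .
qed

text \<open>Fix one optimal \<open>P\<close> and pass to the aligned representative
  \<open>M ** P\<close>. The optimal matrices for \<open>M\<close> are then \<open>P ** Q\<close>
  with \<open>Q\<close> optimal for that representative.\<close>

lemma unique_geodesic_iff_rank:
  fixes L M :: "('t::{finite,linorder}, 'd::finite) bmat"
  assumes L: "L \<in> block_lower_reg" and M: "M \<in> block_lower"
  shows "(\<exists>!\<gamma>. \<gamma> \<in> geodesics_between (abw_class L) (abw_class M)) \<longleftrightarrow>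
      (\<forall>t. rank (block (transpose M ** M) t t) = rank (block (transpose M ** L) t t))"
proof -
  obtain P where P: "P \<in> block_orth" "aligned L (M ** P)" "P \<in> abw_opt L M"
    using abw_opt_nonempty[of L M] by (auto simp: abw_opt_iff)
  have "(\<forall>Q\<in>abw_opt L M. \<forall>R\<in>abw_opt L M. M ** Q = M ** R) \<longleftrightarrow> (\<forall>Q\<in>abw_opt L M. M ** Q = M ** P)"
    using P(3) by metis
  also have "\<dots> \<longleftrightarrow> (\<forall>Q\<in>block_orth. aligned L (M ** P ** Q) \<longrightarrow> M ** P ** Q = M ** P)"
  proof safe
    fix Q :: "('t, 'd) bmat"
    assume *: "\<forall>Q\<in>abw_opt L M. M ** Q = M ** P" and Q: "Q \<in> block_orth" "aligned L (M ** P ** Q)"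
    then have "P ** Q \<in> abw_opt L M"
      using P(1) by (simp add: abw_opt_iff block_orth_mult matrix_mul_assoc)
    with * have "M ** (P ** Q) = M ** P" by blast
    then show "M ** P ** Q = M ** P" by (simp add: matrix_mul_assoc)
  next
    fix Q assume *: "\<forall>Q\<in>block_orth. aligned L (M ** P ** Q) \<longrightarrow> M ** P ** Q = M ** P"
      and "Q \<in> abw_opt L M"
    then have Q: "Q \<in> block_orth" "aligned L (M ** Q)" by (auto simp: abw_opt_iff)
    let ?R = "transpose P ** Q"
    have R: "?R \<in> block_orth" using P Q by (simp add: block_orth_mult block_orthD)
    have "M ** P ** ?R = M ** Q"
      by (simp add: matrix_mul_assoc block_orth_cancel P)
    with * R Q show "M ** Q = M ** P" by metis
  qed
  also have "\<dots> \<longleftrightarrow> (\<forall>t. rank (block (transpose M ** M) t t) = rank (block (transpose M ** L) t t))"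
    using aligned_rank_iff[OF P(2)] unfolding rank_mult_orth(1)[OF P(1)] unfolding rank_mult_orth(2)[OF P(1)] .
  finally show ?thesis by (simp add: unique_geodesic_iff_opt[OF L M])
qed

section \<open>Angles between geodesics\<close>

lemma block_lower_reg_coercive:
  fixes L :: "('t::{finite,linorder}, 'd::finite) bmat"
  assumes "L \<in> block_lower_reg"
  obtains c where "c > 0" "\<And>t x. c * (norm x)\<^sup>2 \<le> x \<bullet> (block (transpose L ** L) t t *v x)"
proof -
  let ?G = "\<lambda>t. block (transpose L ** L) t t"
  have "\<forall>t. \<exists>c>0. \<forall>x. c * (norm x)\<^sup>2 \<le> x \<bullet> (?G t *v x)"
    using assms by (auto simp: block_lower_reg_def intro!: positive_definite_coercive)
  then obtain c where c: "\<And>t. c t > 0" "\<And>t x. c t * (norm x)\<^sup>2 \<le> x \<bullet> (?G t *v x)"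
    by metis
  show thesis
  proof
    show "Min (range c) > 0" using c(1) by (subst Min_gr_iff) auto
    show "Min (range c) * (norm x)\<^sup>2 \<le> x \<bullet> (?G t *v x)" for t x
      using order_trans[OF mult_right_mono c(2), of "Min (range c)" t x] by simp
  qed
qed

text \<open>
  To first order in \<open>u\<close> the points \<open>L + u V\<close> and \<open>L + u W\<close> are aligned; the defect of alignment
  is of order \<open>u\<^sup>2\<close> and, by coercivity, it changes the squared distance only by \<open>O(u\<^sup>4)\<close>.
\<close>

lemma abw_dist_expansion:
  fixes L V W :: "('t::{finite,linorder}, 'd::finite) bmat"
  assumes L: "L \<in> block_lower_reg" and V: "V \<in> opt_dirs L" and W: "W \<in> opt_dirs L"
  obtains C where "\<And>u. 0 < u \<Longrightarrow> u < 1/4 \<Longrightarrow>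
    u\<^sup>2 * (norm (V - W))\<^sup>2 - C * u ^ 4 \<le> (abw_dist (L + u *\<^sub>R V) (L + u *\<^sub>R W))\<^sup>2"
proof -
  have L': "L \<in> block_lower" using L by (simp add: block_lower_reg_def)
  have al: "aligned L (L + V)" "aligned L (L + W)" using V W L' by (auto simp: opt_dirs_iff)
  obtain c where c: "c > 0" "\<And>t x. c * (norm x)\<^sup>2 \<le> x \<bullet> (block (transpose L ** L) t t *v x)"
    using block_lower_reg_coercive[OF L] by metis
  let ?E = "\<lambda>t. block (transpose W ** V) t t"
  show thesis
  proof
    \<comment> \<open>The bound \<open>1/4\<close> keeps \<open>2 * u\<close> inside
      \<open>{0..1}\<close> and gives \<open>1 - 2 * u \<ge> 1/2\<close>, so that half of the
      coercivity of \<open>L\<close> survives at parameter \<open>2 * u\<close>.\<close>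
    fix u :: real assume u: "0 < u" "u < 1/4"
    let ?A = "L + u *\<^sub>R V" and ?B = "L + u *\<^sub>R W"
    let ?K = "\<lambda>t. block (transpose ?B ** ?A) t t"
    obtain P where P: "P \<in> block_orth" "norm (?A - ?B ** P) = abw_dist ?A ?B"
      using abw_dist_attained by blast
    have est: "- (u ^ 4 * (norm (?E t))\<^sup>2 / c) \<le> ?K t \<bullet> (mat 1 - block P t t)" for t
    proof -
      let ?C = "mat 1 - block P t t"
      \<comment> \<open>\<open>?K t\<close> is the sum of \<open>S\<close>, its part up to first
        order in \<open>u\<close>, and \<open>u\<^sup>2 *\<^sub>R ?E t\<close>. As the mean of two
        blocks belonging to points aligned with \<open>L\<close>, at the doubled parameter
        \<open>2 * u\<close>, \<open>S\<close> is symmetric and coercive.\<close>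
      define S1 where "S1 = block (transpose (L + (2 * u) *\<^sub>R W) ** L) t t"
      define S2 where "S2 = block (transpose (L + (2 * u) *\<^sub>R V) ** L) t t"
      define S where "S = (1/2) *\<^sub>R (S1 + S2)"
      have psd: "positive_semidefinite S1" "positive_semidefinite S2"
        using aligned_interpolate[OF al(2), of 0 "2 * u"] aligned_interpolate[OF al(1), of 0 "2 * u"] u
        by (auto simp: aligned_def S1_def S2_def)
      have T2: "transpose S2 = S2"
        using psd by (simp add: positive_semidefinite_def symmetric_matrix_def)
      have sym: "symmetric_matrix S"
        using positive_semidefinite_scaleR[OF positive_semidefinite_add[OF psd], of "1/2"]
        by (simp add: S_def positive_semidefinite_def)
      have half: "c / 2 * (norm x)\<^sup>2 \<le> x \<bullet> (block (transpose (L + (2 * u) *\<^sub>R Z) ** L) t t *v x)"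
        if Z: "aligned L (L + Z)" for Z x
      proof -
        have eq: "block (transpose (L + (2 * u) *\<^sub>R Z) ** L) t t =
            (1 - 2 * u) *\<^sub>R block (transpose L ** L) t t + (2 * u) *\<^sub>R block (transpose (L + Z) ** L) t t"
          using block_interpolate[of L "2 * u" Z 0 t] by simp
        have "c / 2 * (norm x)\<^sup>2 \<le> (1 - 2 * u) * (c * (norm x)\<^sup>2)"
          using mult_right_mono[of "1/2" "1 - 2 * u" "c * (norm x)\<^sup>2"] u c(1) by simp
        also have "\<dots> \<le> (1 - 2 * u) * (x \<bullet> (block (transpose L ** L) t t *v x))"
          using u c(2) by (intro mult_left_mono) auto
        also have "\<dots> \<le> (1 - 2 * u) * (x \<bullet> (block (transpose L ** L) t t *v x))
            + 2 * u * (x \<bullet> (block (transpose (L + Z) ** L) t t *v x))"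
          using Z u by (simp add: aligned_def positive_semidefinite_def)
        also have "\<dots> = x \<bullet> (block (transpose (L + (2 * u) *\<^sub>R Z) ** L) t t *v x)"
          unfolding eq by (simp add: matrix_vector_mult_add_rdistrib inner_add_right
              flip: scaleR_matrix_vector_assoc)
        finally show ?thesis .
      qed
      have "c / 2 * (norm x)\<^sup>2 \<le> x \<bullet> (S *v x)" for x
        using half[OF al(2), of x] half[OF al(1), of x]
        by (simp add: S_def S1_def S2_def matrix_vector_mult_add_rdistrib inner_add_right
            flip: scaleR_matrix_vector_assoc)
      then have "c / 2 / 2 * (norm ?C)\<^sup>2 \<le> S \<bullet> ?C"
        by (rule inner_orthogonal_coercive[OF sym block_orthD(4)[OF P(1)]])
      moreover have "- (norm (?E t) * norm ?C) \<le> ?E t \<bullet> ?C"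
        using Cauchy_Schwarz_ineq2[of "?E t" ?C] by linarith
      then have "u\<^sup>2 * - (norm (?E t) * norm ?C) \<le> u\<^sup>2 * (?E t \<bullet> ?C)"
        by (intro mult_left_mono) auto
      moreover have "?K t = S + u\<^sup>2 *\<^sub>R ?E t"
      proof -
        have "transpose S2 = block (transpose L ** (L + (2 * u) *\<^sub>R V)) t t"
          unfolding S2_def block_transpose[symmetric] by (simp only: matrix_transpose_mul transpose_transpose)
        then have "S2 = block (transpose L ** (L + (2 * u) *\<^sub>R V)) t t" by (simp only: T2)
        then show ?thesis
          by (simp add: S_def S1_def transpose_add matrix_mult_scaleR transpose_scalar matrix_add_ldistrib matrix_add_rdistrib
              block_add block_scaleR) (simp add: algebra_simps power2_eq_square flip: scaleR_add_left)
      qed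
      then have "?K t \<bullet> ?C = S \<bullet> ?C + u\<^sup>2 * (?E t \<bullet> ?C)"
        by (simp only: inner_add_left inner_scaleR_left)
      moreover have "- (u ^ 4 * (norm (?E t))\<^sup>2 / c) \<le> c / 2 / 2 * (norm ?C)\<^sup>2 - u\<^sup>2 * (norm (?E t) * norm ?C)"
      proof -
        \<comment> \<open>Completing the square in \<open>norm ?C\<close> absorbs the mixed term,
          leaving an error of order \<open>u ^ 4\<close> that does not involve
          \<open>P\<close>.\<close>
        have "0 \<le> (c * norm ?C / 2 - u\<^sup>2 * norm (?E t))\<^sup>2 / c"
          using c(1) by simp
        also have "\<dots> = c / 2 / 2 * (norm ?C)\<^sup>2 - u\<^sup>2 * (norm (?E t) * norm ?C) + u ^ 4 * (norm (?E t))\<^sup>2 / c"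
          using c(1) by (simp add: field_simps power2_eq_square power4_eq_xxxx)
        finally show ?thesis by linarith
      qed
      ultimately show ?thesis by linarith
    qed
    have "(norm (?A - ?B ** P))\<^sup>2 = (norm (?A - ?B ** mat 1))\<^sup>2 + 2 * ((transpose ?B ** ?A) \<bullet> (mat 1 - P))"
      unfolding norm_diff_orth_squared[OF P(1)] norm_diff_orth_squared[OF mat_1_in_block_orth]
      by (simp add: inner_diff_right)
    also have "(transpose ?B ** ?A) \<bullet> (mat 1 - P) = (\<Sum>t\<in>UNIV. ?K t \<bullet> (mat 1 - block P t t))"
      by (simp add: inner_diff_right inner_block_orth[OF P(1)] inner_mat_1_blocks sum_subtractf)
    also have "?A - ?B ** mat 1 = u *\<^sub>R (V - W)"
      by (simp add: scaleR_diff_right)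
    also have "(norm (u *\<^sub>R (V - W)))\<^sup>2 = u\<^sup>2 * (norm (V - W))\<^sup>2"
      by (simp add: power_mult_distrib)
    finally have eq: "(abw_dist ?A ?B)\<^sup>2 = u\<^sup>2 * (norm (V - W))\<^sup>2
        + 2 * (\<Sum>t\<in>UNIV. ?K t \<bullet> (mat 1 - block P t t))"
      using P(2) by simp
    have "(\<Sum>t\<in>UNIV. - (u ^ 4 * (norm (?E t))\<^sup>2 / c)) \<le> (\<Sum>t\<in>UNIV. ?K t \<bullet> (mat 1 - block P t t))"
      by (intro sum_mono est)
    moreover have "(\<Sum>t\<in>UNIV. - (u ^ 4 * (norm (?E t))\<^sup>2 / c)) = - ((\<Sum>t\<in>UNIV. (norm (?E t))\<^sup>2 / c) * u ^ 4)"
      by (simp add: sum_negf sum_distrib_left mult_ac)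
    ultimately show "u\<^sup>2 * (norm (V - W))\<^sup>2 - (2 * (\<Sum>t\<in>UNIV. (norm (?E t))\<^sup>2 / c)) * u ^ 4 \<le> (abw_dist ?A ?B)\<^sup>2"
      unfolding eq by linarith
  qed
qed

text \<open>The quotient is squeezed. The bound of \<open>abw_dist\<close> by the Frobenius distance
  puts it above the Euclidean cosine, and \<open>abw_dist_expansion\<close> puts it below that
  cosine plus a multiple of \<open>u\<^sup>2\<close>.\<close>

lemma geo_angle_segment:
  assumes L: "L \<in> block_lower_reg" and V: "V \<in> opt_dirs L" "V \<noteq> 0" and W: "W \<in> opt_dirs L" "W \<noteq> 0"
  shows "geo_angle (abw_class L) (segment_curve L V) (segment_curve L W) = arccos (sgn V \<bullet> sgn W)"
proof -
  have L': "L \<in> block_lower" using L by (simp add: block_lower_reg_def)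
  have lower: "V \<in> block_lower" "W \<in> block_lower" using V W L' by (auto simp: opt_dirs_iff)
  let ?X = "abw_class L" and ?d = "\<lambda>u. abw_dist (L + u *\<^sub>R V) (L + u *\<^sub>R W)"
  let ?q = "\<lambda>u. ((abw_qdist ?X (segment_curve L V u))\<^sup>2 + (abw_qdist ?X (segment_curve L W u))\<^sup>2
      - (abw_qdist (segment_curve L V u) (segment_curve L W u))\<^sup>2)
      / (2 * abw_qdist ?X (segment_curve L V u) * abw_qdist ?X (segment_curve L W u))"
  obtain C where C: "\<And>u. 0 < u \<Longrightarrow> u < 1/4 \<Longrightarrow>
      u\<^sup>2 * (norm (V - W))\<^sup>2 - C * u ^ 4 \<le> (?d u)\<^sup>2"
    using abw_dist_expansion[OF L V(1) W(1)] by metis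
  let ?c = "sgn V \<bullet> sgn W"
  have c: "?c = ((norm V)\<^sup>2 + (norm W)\<^sup>2 - (norm (V - W))\<^sup>2) / (2 * norm V * norm W)"
    using V W by (simp add: sgn_div_norm power2_norm_eq_inner inner_diff_left inner_diff_right inner_commute field_simps)
  have bounds: "?c \<le> ?q u" "?q u \<le> ?c + C * u\<^sup>2 / (2 * norm V * norm W)" if u: "0 < u" "u < 1/4" for u
  proof -
    have q: "?q u = (u\<^sup>2 * (norm V)\<^sup>2 + u\<^sup>2 * (norm W)\<^sup>2 - (?d u)\<^sup>2) / (2 * (u\<^sup>2 * (norm V * norm W)))"
      using abw_qdist_segment[OF L' V(1), of 0 u] abw_qdist_segment[OF L' W(1), of 0 u] u
      by (simp add: segment_curve_def abw_qdist_class L' lower block_lower_segment power_mult_distrib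
          power2_eq_square mult_ac)
    have D: "0 < 2 * (u\<^sup>2 * (norm V * norm W))" using u V W by simp
    have "?d u \<le> norm ((L + u *\<^sub>R V) - (L + u *\<^sub>R W))" by (rule abw_dist_le_norm)
    also have "(L + u *\<^sub>R V) - (L + u *\<^sub>R W) = u *\<^sub>R (V - W)" by (simp add: scaleR_diff_right)
    finally have "(?d u)\<^sup>2 \<le> (norm (u *\<^sub>R (V - W)))\<^sup>2"
      by (intro power_mono abw_dist_nonneg)
    then have up: "(?d u)\<^sup>2 \<le> u\<^sup>2 * (norm (V - W))\<^sup>2" by (simp add: power_mult_distrib)
    have "?c = (u\<^sup>2 * (norm V)\<^sup>2 + u\<^sup>2 * (norm W)\<^sup>2 - u\<^sup>2 * (norm (V - W))\<^sup>2) / (2 * (u\<^sup>2 * (norm V * norm W)))"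
      unfolding c using u V W by (simp add: field_simps)
    also have "\<dots> \<le> ?q u" unfolding q using up D by (intro divide_right_mono) auto
    finally show "?c \<le> ?q u" .
    have "?q u \<le> (u\<^sup>2 * (norm V)\<^sup>2 + u\<^sup>2 * (norm W)\<^sup>2 - (u\<^sup>2 * (norm (V - W))\<^sup>2 - C * u ^ 4))
        / (2 * (u\<^sup>2 * (norm V * norm W)))"
      unfolding q using C[OF u] D by (intro divide_right_mono) auto
    also have "\<dots> = ?c + C * u\<^sup>2 / (2 * norm V * norm W)"
      unfolding c using u V W by (simp add: field_simps power4_eq_xxxx power2_eq_square)
    finally show "?q u \<le> ?c + C * u\<^sup>2 / (2 * norm V * norm W)" .
  qed
  have ev: "eventually (\<lambda>u. 0 < u \<and> u < 1/4) (at_right (0::real))"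
    unfolding eventually_at_right_field by (intro exI[of _ "1/4"]) auto
  have "((\<lambda>u. ?c + C * u\<^sup>2 / (2 * norm V * norm W)) \<longlongrightarrow> ?c + C * 0\<^sup>2 / (2 * norm V * norm W)) (at_right 0)"
    using V W by (intro tendsto_intros) auto
  then have lim: "((\<lambda>u. ?c + C * u\<^sup>2 / (2 * norm V * norm W)) \<longlongrightarrow> ?c) (at_right 0)" by simp
  have "(?q \<longlongrightarrow> ?c) (at_right 0)"
    by (rule tendsto_sandwich[OF _ _ tendsto_const lim]; rule eventually_mono[OF ev]) (use bounds in auto)
  then have "Lim (at_right 0) ?q = ?c" by (intro tendsto_Lim) auto
  then show ?thesis by (simp add: geo_angle_def)
qed

section \<open>Kernel quotients, completions and cones\<close>

text \<open>
  All quotients in the construction of the tangent cone are by relations \<open>f x = f y\<close>, where \<open>f\<close> takes values in the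
  Euclidean space of matrices; \<open>lift_map f\<close> is the induced injection of the quotient.
\<close>

definition kernel_rel :: "'a set \<Rightarrow> ('a \<Rightarrow> 'b) \<Rightarrow> ('a \<times> 'a) set" where
  "kernel_rel A f = {(x, y). x \<in> A \<and> y \<in> A \<and> f x = f y}"

definition lift_map :: "('a \<Rightarrow> 'b) \<Rightarrow> 'a set \<Rightarrow> 'b" where
  "lift_map f c = the_elem (f ` c)"

lemma lift_map_class: "x \<in> A \<Longrightarrow> lift_map f (kernel_rel A f `` {x}) = f x"
proof -
  assume "x \<in> A"
  then have "f ` (kernel_rel A f `` {x}) = {f x}" by (auto simp: kernel_rel_def)
  then show ?thesis by (simp add: lift_map_def)
qed

lemma kernel_class_eq: "x \<in> A \<Longrightarrow> y \<in> A \<Longrightarrow> f x = f y \<Longrightarrow> kernel_rel A f `` {x} = kernel_rel A f `` {y}"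
  by (auto simp: kernel_rel_def)

lemma bij_betw_lift_map: "bij_betw (lift_map f) (A // kernel_rel A f) (f ` A)"
proof (rule bij_betw_imageI)
  show "inj_on (lift_map f) (A // kernel_rel A f)"
  proof (rule inj_onI)
    fix p q assume "p \<in> A // kernel_rel A f" "q \<in> A // kernel_rel A f" and eq: "lift_map f p = lift_map f q"
    then obtain x y where xy: "x \<in> A" "p = kernel_rel A f `` {x}" "y \<in> A" "q = kernel_rel A f `` {y}"
      by (auto elim!: quotientE)
    with eq have "f x = f y" by (simp add: lift_map_class)
    with xy show "p = q" using kernel_class_eq by metis
  qed
  show "lift_map f ` (A // kernel_rel A f) = f ` A"
    by (force simp: quotient_def lift_map_class image_iff)
qed

lemma lift_dist_kernel:
  assumes "p \<in> A // kernel_rel A f" "q \<in> A // kernel_rel A f"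
    and d: "\<And>x y. x \<in> A \<Longrightarrow> y \<in> A \<Longrightarrow> d x y = D (f x) (f y)"
  shows "lift_dist d p q = D (lift_map f p) (lift_map f q)"
proof -
  obtain x y where xy: "x \<in> A" "p = kernel_rel A f `` {x}" "y \<in> A" "q = kernel_rel A f `` {y}"
    using assms by (auto elim!: quotientE)
  have "(\<lambda>(x, y). d x y) ` (p \<times> q) = {D (f x) (f y)}"
  proof (intro equalityI subsetI)
    fix r assume "r \<in> {D (f x) (f y)}"
    moreover have "(x, y) \<in> p \<times> q" using xy by (auto simp: kernel_rel_def)
    ultimately show "r \<in> (\<lambda>(x, y). d x y) ` (p \<times> q)" using d xy by (force intro!: image_eqI[of _ _ "(x, y)"])
  qed (use xy d in \<open>auto simp: kernel_rel_def\<close>)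
  then show ?thesis
    using xy by (simp add: lift_dist_def lift_map_class)
qed

section \<open>Angles between unit vectors\<close>

lemma unit_inner_bounds:
  fixes a b :: "'a::real_inner"
  assumes "norm a = 1" "norm b = 1" shows "-1 \<le> a \<bullet> b" "a \<bullet> b \<le> 1"
proof -
  have "\<bar>a \<bullet> b\<bar> \<le> 1"
    using Cauchy_Schwarz_ineq2[of a b] by (simp only: assms mult_1)
  then show "-1 \<le> a \<bullet> b" "a \<bullet> b \<le> 1" by auto
qed

text \<open>A chord, of length twice the sine of half the angle, is no longer than its arc. Cauchy
  sequences for the angle are therefore Cauchy in norm.\<close>

lemma norm_diff_le_arccos:
  fixes a b :: "'a::real_inner"
  assumes "norm a = 1" "norm b = 1"
  shows "norm (a - b) \<le> arccos (a \<bullet> b)"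
proof (rule power2_le_imp_le)
  let ?t = "arccos (a \<bullet> b)"
  note ab = unit_inner_bounds[OF assms]
  have "(norm (a - b))\<^sup>2 = 2 - 2 * (a \<bullet> b)"
    using assms by (simp add: power2_norm_eq_inner inner_diff_left inner_diff_right inner_commute norm_eq_1)
  also have "\<dots> = 2 - 2 * cos (2 * (?t / 2))" using ab by simp
  also have "\<dots> = 4 * (sin (?t / 2))\<^sup>2"
    by (subst cos_double_sin) simp
  also have "\<dots> \<le> 4 * (?t / 2)\<^sup>2"
    using iffD1[OF abs_le_square_iff abs_sin_x_le_abs_x[of "?t / 2"]] by (intro mult_left_mono) auto
  finally show "(norm (a - b))\<^sup>2 \<le> ?t\<^sup>2" by (simp add: power2_eq_square)
  show "0 \<le> ?t" using ab by (rule arccos_lbound)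
qed

lemma arccos_inner_eq_0_iff:
  fixes a b :: "'a::real_inner"
  assumes "norm a = 1" "norm b = 1"
  shows "arccos (a \<bullet> b) = 0 \<longleftrightarrow> a = b"
proof
  assume "arccos (a \<bullet> b) = 0"
  then show "a = b" using norm_diff_le_arccos[OF assms] by simp
next
  assume "a = b"
  then show "arccos (a \<bullet> b) = 0"
    using assms by (simp add: norm_eq_sqrt_inner)
qed

lemma tendsto_arccos_inner:
  fixes a b :: "'a::real_inner"
  assumes "x \<longlonglongrightarrow> a" "y \<longlonglongrightarrow> b" "\<And>n. norm (x n) = 1" "\<And>n. norm (y n) = 1"
  shows "(\<lambda>n. arccos (x n \<bullet> y n)) \<longlonglongrightarrow> arccos (a \<bullet> b)"
proof -
  have 1: "norm a = 1" "norm b = 1"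
    using tendsto_norm[OF assms(1)] tendsto_norm[OF assms(2)]
    by (simp_all only: assms(3,4) LIMSEQ_const_iff)
  show ?thesis
    by (rule continuous_on_tendsto_compose[OF continuous_on_arccos' tendsto_inner[OF assms(1,2)]])
      (simp_all add: unit_inner_bounds 1 assms(3,4) del: norm_eq_1)
qed

text \<open>The invariant carried through the quotient and the completion: a model of the space
  inside the unit sphere with the angular distance. Closedness of \<open>U\<close> supplies limits,
  so completing enlarges nothing.\<close>

definition complete_angular :: "'a set \<Rightarrow> ('a \<Rightarrow> 'a \<Rightarrow> real) \<Rightarrow> ('a \<Rightarrow> 'e::euclidean_space) \<Rightarrow> 'e set \<Rightarrow> bool" where
  "complete_angular S d g U \<longleftrightarrow> closed U \<and> (\<forall>a\<in>U. norm a = 1) \<and> bij_betw g S U \<and>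
     (\<forall>x\<in>S. \<forall>y\<in>S. d x y = arccos (g x \<bullet> g y))"

lemma complete_angularD:
  assumes "complete_angular S d g U"
  shows "closed U" "a \<in> U \<Longrightarrow> norm a = 1" "x \<in> S \<Longrightarrow> norm (g x) = 1" "inj_on g S" "g ` S = U"
    and "x \<in> S \<Longrightarrow> y \<in> S \<Longrightarrow> d x y = arccos (g x \<bullet> g y)"
  using assms by (auto simp: complete_angular_def bij_betw_def)

lemma complete_angular_quotient:
  assumes "closed U" "\<And>a. a \<in> U \<Longrightarrow> norm a = 1" "g ` A = U"
    and d: "\<And>x y. x \<in> A \<Longrightarrow> y \<in> A \<Longrightarrow> d x y = arccos (g x \<bullet> g y)"
  shows "complete_angular (A // kernel_rel A g) (lift_dist d) (lift_map g) U"
  using assms bij_betw_lift_map[of g A] lift_dist_kernel[of _ A g _ d "\<lambda>a b. arccos (a \<bullet> b)"]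
  by (simp add: complete_angular_def)

lemma cauchy_seqs_tendsto:
  assumes ca: "complete_angular S d g U" and x: "x \<in> cauchy_seqs S d"
  shows "(\<lambda>n. g (x n)) \<longlonglongrightarrow> lim (\<lambda>n. g (x n))" "lim (\<lambda>n. g (x n)) \<in> U"
proof -
  have xS: "x n \<in> S" for n using x by (auto simp: cauchy_seqs_def)
  have g1: "norm (g (x n)) = 1" for n
    by (rule complete_angularD(3)[OF ca xS])
  have "Cauchy (\<lambda>n. g (x n))"
  proof (rule CauchyI)
    fix e :: real assume "0 < e"
    then have "\<exists>N. \<forall>m\<ge>N. \<forall>n\<ge>N. d (x m) (x n) < e"
      using x by (simp add: cauchy_seqs_def)
    then obtain N where N: "\<And>m n. m \<ge> N \<Longrightarrow> n \<ge> N \<Longrightarrow> d (x m) (x n) < e"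
      by metis
    have "norm (g (x m) - g (x n)) < e" if "m \<ge> N" "n \<ge> N" for m n
      using N[OF that] norm_diff_le_arccos[OF g1[of m] g1[of n]]
      by (simp only: complete_angularD(6)[OF ca xS xS])
    then show "\<exists>M. \<forall>m\<ge>M. \<forall>n\<ge>M. norm (g (x m) - g (x n)) < e" by blast
  qed
  then show lim: "(\<lambda>n. g (x n)) \<longlonglongrightarrow> lim (\<lambda>n. g (x n))"
    using Cauchy_convergent convergent_LIMSEQ_iff by blast
  show "lim (\<lambda>n. g (x n)) \<in> U"
    using closed_sequentially[OF complete_angularD(1)[OF ca] _ lim] complete_angularD(5)[OF ca] xS by blast
qed

text \<open>By continuity of \<open>arccos\<close> the distances converge to the angle between the
  limits, which is \<open>0\<close> only if the limits agree. The completion is thus the kernel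
  quotient by the limit map.\<close>

lemma completion_rel_eq_kernel:
  assumes ca: "complete_angular S d g U"
  shows "completion_rel S d = kernel_rel (cauchy_seqs S d) (\<lambda>x. lim (\<lambda>n. g (x n)))"
    and "x \<in> cauchy_seqs S d \<Longrightarrow> y \<in> cauchy_seqs S d \<Longrightarrow>
      lim (\<lambda>n. d (x n) (y n)) = arccos (lim (\<lambda>n. g (x n)) \<bullet> lim (\<lambda>n. g (y n)))"
proof -
  have main: "(\<lambda>n. d (x n) (y n)) \<longlonglongrightarrow> arccos (lim (\<lambda>n. g (x n)) \<bullet> lim (\<lambda>n. g (y n)))"
    if "x \<in> cauchy_seqs S d" "y \<in> cauchy_seqs S d" for x y
  proof -
    have S: "x n \<in> S" "y n \<in> S" for n using that by (auto simp: cauchy_seqs_def)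
    then have "(\<lambda>n. d (x n) (y n)) = (\<lambda>n. arccos (g (x n) \<bullet> g (y n)))"
      using complete_angularD(6)[OF ca] by blast
    then show ?thesis
      using tendsto_arccos_inner[OF cauchy_seqs_tendsto(1)[OF ca that(1)] cauchy_seqs_tendsto(1)[OF ca that(2)]]
        complete_angularD(3)[OF ca] S by simp
  qed
  then show "x \<in> cauchy_seqs S d \<Longrightarrow> y \<in> cauchy_seqs S d \<Longrightarrow>
      lim (\<lambda>n. d (x n) (y n)) = arccos (lim (\<lambda>n. g (x n)) \<bullet> lim (\<lambda>n. g (y n)))"
    by (blast intro: limI)
  have "(\<lambda>n. d (x n) (y n)) \<longlonglongrightarrow> 0 \<longleftrightarrow> lim (\<lambda>n. g (x n)) = lim (\<lambda>n. g (y n))"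
    if "x \<in> cauchy_seqs S d" "y \<in> cauchy_seqs S d" for x y
  proof -
    have "(\<lambda>n. d (x n) (y n)) \<longlonglongrightarrow> 0 \<longleftrightarrow> arccos (lim (\<lambda>n. g (x n)) \<bullet> lim (\<lambda>n. g (y n))) = 0"
      using main[OF that] LIMSEQ_unique by metis
    then show ?thesis
      using arccos_inner_eq_0_iff complete_angularD(2)[OF ca] cauchy_seqs_tendsto(2)[OF ca] that by metis
  qed
  then show "completion_rel S d = kernel_rel (cauchy_seqs S d) (\<lambda>x. lim (\<lambda>n. g (x n)))"
    unfolding completion_rel_def kernel_rel_def by blast
qed

definition completion_map :: "('a \<Rightarrow> 'e::euclidean_space) \<Rightarrow> (nat \<Rightarrow> 'a) set \<Rightarrow> 'e" where
  "completion_map g = lift_map (\<lambda>x. lim (\<lambda>n. g (x n)))"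

lemma const_cauchy_seqs:
  assumes "complete_angular S d g U" "x \<in> S"
  shows "(\<lambda>_. x) \<in> cauchy_seqs S d"
proof -
  have "d x x = 0"
    using complete_angularD(3,6)[OF assms(1)] assms(2) arccos_inner_eq_0_iff[of "g x" "g x"] by simp
  with assms show ?thesis by (auto simp: cauchy_seqs_def)
qed

lemma completion_map_embed:
  assumes ca: "complete_angular S d g U" and x: "x \<in> S"
  shows "completion_map g (completion_embed S d x) = g x" "completion_embed S d x \<in> completion S d"
  unfolding completion_map_def completion_embed_def completion_def completion_rel_eq_kernel(1)[OF ca]
  using const_cauchy_seqs[OF ca x] by (simp_all add: lift_map_class limI quotientI)

text \<open>Limits stay in the closed set \<open>U\<close>, and constant sequences already reach all
  of it, so the same \<open>U\<close> models the completion.\<close>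

lemma complete_angular_completion:
  assumes ca: "complete_angular S d g U"
  shows "complete_angular (completion S d) (completion_dist d) (completion_map g) U"
proof -
  have "(\<lambda>x. lim (\<lambda>n. g (x n))) ` cauchy_seqs S d = U"
  proof (intro equalityI subsetI)
    fix a assume "a \<in> U"
    then obtain x where x: "x \<in> S" "g x = a" using complete_angularD(5)[OF ca] by blast
    then have "a = lim (\<lambda>n. g x)" by (simp add: limI)
    then show "a \<in> (\<lambda>x. lim (\<lambda>n. g (x n))) ` cauchy_seqs S d"
      using const_cauchy_seqs[OF ca x(1)] by (rule image_eqI)
  qed (use cauchy_seqs_tendsto(2)[OF ca] in blast)
  moreover have "completion_dist d p q = arccos (completion_map g p \<bullet> completion_map g q)"
    if "p \<in> completion S d" "q \<in> completion S d" for p q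
    using that completion_rel_eq_kernel(2)[OF ca]
    unfolding completion_dist_def completion_map_def completion_def completion_rel_eq_kernel(1)[OF ca]
    by (intro lift_dist_kernel[where D = "\<lambda>a b. arccos (a \<bullet> b)"])
  ultimately show ?thesis
    using complete_angularD(1,2)[OF ca] bij_betw_lift_map[of "\<lambda>x. lim (\<lambda>n. g (x n))" "cauchy_seqs S d"]
    unfolding complete_angular_def completion_map_def completion_def completion_rel_eq_kernel(1)[OF ca]
    by auto
qed

text \<open>Polar coordinates: the norm recovers the radius, and a nonzero radius then recovers the
  direction. Only the zero vector has several preimages, which are exactly the points identified to
  the tip.\<close>

lemma cone_rel_eq_kernel:
  assumes ca: "complete_angular S d h U"
  shows "cone_rel S = kernel_rel (S \<times> {0..}) (\<lambda>(x, r). r *\<^sub>R h x)"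
proof -
  have "x = y \<and> r = s \<or> r = 0 \<and> s = 0" if "x \<in> S" "y \<in> S" "0 \<le> r" "0 \<le> s" "r *\<^sub>R h x = s *\<^sub>R h y" for x y r s
  proof -
    have "r = s"
      using arg_cong[OF that(5), of norm] that(3,4) complete_angularD(3)[OF ca that(1)]
        complete_angularD(3)[OF ca that(2)]
      by (simp only: norm_scaleR abs_of_nonneg mult_1_right)
    then show ?thesis
      using that complete_angularD(4)[OF ca] by (cases "r = 0") (auto dest: inj_onD)
  qed
  then show ?thesis
    by (fastforce simp: cone_rel_def kernel_rel_def)
qed

definition cone_map :: "('a \<Rightarrow> 'e::euclidean_space) \<Rightarrow> ('a \<times> real) set \<Rightarrow> 'e" where
  "cone_map h = lift_map (\<lambda>(x, r). r *\<^sub>R h x)"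

lemma cone_map_point:
  assumes ca: "complete_angular S d h U" and "x \<in> S" "0 \<le> r"
  shows "cone_map h (cone_point S x r) = r *\<^sub>R h x" "cone_point S x r \<in> cone S"
  using assms(2,3) lift_map_class[of "(x, r)" "S \<times> {0..}" "\<lambda>(x, r). r *\<^sub>R h x"]
  unfolding cone_map_def cone_point_def cone_def cone_rel_eq_kernel[OF ca]
  by (auto intro!: quotientI)

lemma cone_tip_eq_point: "x \<in> S \<Longrightarrow> cone_tip S = cone_point S x 0"
  by (auto simp: cone_tip_def cone_point_def cone_rel_def)

lemma coneE:
  assumes "p \<in> cone S" obtains x r where "x \<in> S" "0 \<le> r" "p = cone_point S x r"
  using assms unfolding cone_def cone_point_def by (auto elim!: quotientE)

text \<open>For unit vectors the law of cosines in \<open>cone_dist\<close> is the expansion of the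
  Euclidean distance between \<open>r *\<^sub>R h x\<close> and
  \<open>s *\<^sub>R h y\<close>.\<close>

lemma cone_map_isometry:
  assumes ca: "complete_angular S d h U"
  shows "bij_betw (cone_map h) (cone S) {r *\<^sub>R a | r a. 0 \<le> r \<and> a \<in> U}"
    and "p \<in> cone S \<Longrightarrow> q \<in> cone S \<Longrightarrow> norm (cone_map h p - cone_map h q) = cone_dist d p q"
proof -
  have "(\<lambda>(x, r). r *\<^sub>R h x) ` (S \<times> {0..}) = {r *\<^sub>R a | r a. 0 \<le> r \<and> a \<in> U}"
    using complete_angularD(5)[OF ca] by force
  then show "bij_betw (cone_map h) (cone S) {r *\<^sub>R a | r a. 0 \<le> r \<and> a \<in> U}"
    using bij_betw_lift_map[of "\<lambda>(x, r). r *\<^sub>R h x" "S \<times> {0..}"]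
    unfolding cone_map_def cone_def cone_rel_eq_kernel[OF ca] by simp
  have law: "sqrt (r\<^sup>2 + s\<^sup>2 - 2 * r * s * cos (d x y)) = norm (r *\<^sub>R h x - s *\<^sub>R h y)" if "x \<in> S" "y \<in> S" for x y r s
  proof -
    have 1: "norm (h x) = 1" "norm (h y) = 1" using complete_angularD(3)[OF ca] that by auto
    then have "cos (d x y) = h x \<bullet> h y"
      using complete_angularD(6)[OF ca that] cos_arccos[OF unit_inner_bounds] by simp
    moreover have "h x \<bullet> h x = 1" "h y \<bullet> h y = 1" using 1 by (simp_all add: norm_eq_sqrt_inner)
    ultimately show ?thesis
      by (simp add: norm_eq_sqrt_inner inner_diff_left inner_diff_right inner_commute power2_eq_square algebra_simps)
  qed
  show "norm (cone_map h p - cone_map h q) = cone_dist d p q" if "p \<in> cone S" "q \<in> cone S"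
    using that unfolding cone_map_def cone_def cone_dist_def cone_rel_eq_kernel[OF ca]
    by (intro lift_dist_kernel[where D = "\<lambda>a b. norm (a - b)", symmetric]) (auto simp: law)
qed

section \<open>The tangent cone and the logarithm\<close>

lemma subspace_sym_dirs: "subspace (sym_dirs L)"
proof -
  have "symmetric_matrix (A + B)" if "symmetric_matrix A" "symmetric_matrix B" for A B :: "real^'c^'c"
    using that by (simp add: symmetric_matrix_def transpose_def vec_eq_iff)
  moreover have "symmetric_matrix (c *\<^sub>R A)" if "symmetric_matrix A" for A :: "real^'c^'c" and c
    using that by (simp add: symmetric_matrix_def transpose_scalar)
  ultimately show ?thesis
    by (auto simp: subspace_def sym_dirs_def subspace_0[OF subspace_block_lower]
        subspace_add[OF subspace_block_lower] subspace_scale[OF subspace_block_lower]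
        transpose_scalar transpose_add matrix_mult_scaleR matrix_add_rdistrib block_add block_scaleR)
      (simp_all add: symmetric_matrix_def transpose_def vec_eq_iff matrix_matrix_mult_def block_def)
qed

lemma block_transpose_add_mult:
  "block (transpose (L + V) ** L) t t = block (transpose L ** L) t t + block (transpose V ** L) t t"
  by (simp add: transpose_add matrix_add_rdistrib block_add)

lemma symmetric_gram_block: "symmetric_matrix (block (transpose L ** L) t t)"
  for L :: "('t::finite, 'd::finite) bmat"
  using aligned_refl[of L] by (simp add: aligned_def positive_semidefinite_def)

lemma opt_dirs_subset_sym_dirs:
  assumes "L \<in> block_lower" shows "opt_dirs L \<subseteq> sym_dirs L"
proof
  fix V assume "V \<in> opt_dirs L"
  then have V: "V \<in> block_lower" "aligned L (L + V)" using assms by (auto simp: opt_dirs_iff)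
  have "symmetric_matrix (block (transpose V ** L) t t)" for t
  proof -
    have "symmetric_matrix (block (transpose L ** L) t t + block (transpose V ** L) t t)"
      using V(2) by (simp only: aligned_def positive_semidefinite_def block_transpose_add_mult)
    then show ?thesis
      using symmetric_gram_block[of L t] by (simp add: symmetric_matrix_def transpose_def vec_eq_iff)
  qed
  with V show "V \<in> sym_dirs L" by (simp add: sym_dirs_def)
qed

text \<open>The Gram blocks of a regular \<open>L\<close> are uniformly definite, so a small enough
  symmetric perturbation leaves them positive semidefinite.\<close>

lemma sym_dirs_small_in_opt_dirs:
  fixes L V :: "('t::{finite,linorder}, 'd::finite) bmat"
  assumes L: "L \<in> block_lower_reg" and V: "V \<in> sym_dirs L"
  shows "\<exists>e>0. e *\<^sub>R V \<in> opt_dirs L"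
proof -
  have L': "L \<in> block_lower" using L by (simp add: block_lower_reg_def)
  obtain c where c: "c > 0" "\<And>t x. c * (norm x)\<^sup>2 \<le> x \<bullet> (block (transpose L ** L) t t *v x)"
    using block_lower_reg_coercive[OF L] by metis
  let ?A = "\<lambda>t. block (transpose V ** L) t t"
  \<comment> \<open>A common bound for all blocks; the summand \<open>1\<close> keeps it positive
    when they vanish, so that \<open>c / K\<close> is a valid scale.\<close>
  define K where "K = 1 + (\<Sum>t\<in>UNIV. norm (?A t))"
  have K: "norm (?A t) \<le> K" "K > 0" for t
  proof -
    have "norm (?A t) \<le> (\<Sum>t\<in>UNIV. norm (?A t))" by (rule member_le_sum) auto
    then show "norm (?A t) \<le> K" by (simp add: K_def)
    show "K > 0" unfolding K_def by (intro add_pos_nonneg sum_nonneg) auto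
  qed
  define e where "e = c / K"
  have e: "e > 0" "e * K = c" using c K(2) by (auto simp: e_def)
  have block: "block (transpose (L + e *\<^sub>R V) ** L) t t = block (transpose L ** L) t t + e *\<^sub>R ?A t" for t
    by (simp add: block_transpose_add_mult transpose_scalar block_scaleR flip: scalar_matrix_assoc)
  have "positive_semidefinite (block (transpose L ** L) t t + e *\<^sub>R ?A t)" for t
  proof -
    have "symmetric_matrix (?A t)" using V by (simp add: sym_dirs_def)
    then have "symmetric_matrix (block (transpose L ** L) t t + e *\<^sub>R ?A t)"
      using symmetric_gram_block[of L t] by (simp add: symmetric_matrix_def transpose_def vec_eq_iff)
    moreover have "0 \<le> x \<bullet> ((block (transpose L ** L) t t + e *\<^sub>R ?A t) *v x)" for x
    proof -
      have "\<bar>x \<bullet> (?A t *v x)\<bar> \<le> K * (norm x)\<^sup>2"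
        using quadratic_form_bound[of x "?A t"] mult_right_mono[OF K(1)[of t], of "(norm x)\<^sup>2"] by simp
      then have "e * - (x \<bullet> (?A t *v x)) \<le> e * (K * (norm x)\<^sup>2)"
        using e by (intro mult_left_mono) auto
      also have "\<dots> = c * (norm x)\<^sup>2" using e(2) by (simp flip: mult.assoc)
      also have "\<dots> \<le> x \<bullet> (block (transpose L ** L) t t *v x)" by (rule c(2))
      finally show ?thesis
        by (simp add: matrix_vector_mult_add_rdistrib inner_add_right flip: scaleR_matrix_vector_assoc)
    qed
    ultimately show ?thesis by (simp add: positive_semidefinite_def)
  qed
  then have "aligned L (L + e *\<^sub>R V)" by (simp add: aligned_def block)
  moreover have "e *\<^sub>R V \<in> block_lower"
    using V by (simp add: sym_dirs_def subspace_scale[OF subspace_block_lower])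
  ultimately show ?thesis using e L' by (auto simp: opt_dirs_iff)
qed

section \<open>The space of directions\<close>

lemma zero_in_opt_dirs: "L \<in> block_lower \<Longrightarrow> 0 \<in> opt_dirs L"
  by (simp add: opt_dirs_iff aligned_refl subspace_0[OF subspace_block_lower])

lemma nonconst_geodesics_eq:
  assumes L: "L \<in> block_lower_reg"
  shows "nonconst_geodesics (abw_class L) = segment_curve L ` (opt_dirs L - {0})"
proof -
  have L': "L \<in> block_lower" using L by (simp add: block_lower_reg_def)
  have "geodesics_from (abw_class L) = segment_curve L ` opt_dirs L"
    using geodesic_is_segment[OF L] segment_curve_geodesic[OF L'] by blast
  moreover have "inj_on (segment_curve L) (opt_dirs L)"
    using segment_curve_inj[OF L] by (blast intro: inj_onI)
  moreover have "restrict (\<lambda>_. abw_class L) {0..1} = segment_curve L 0"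
    by (simp add: segment_curve_def)
  ultimately show ?thesis
    unfolding nonconst_geodesics_def using zero_in_opt_dirs[OF L'] by (simp add: inj_on_image_set_diff)
qed

lemma geodesic_dir_segment:
  assumes L: "L \<in> block_lower_reg" and V: "V \<in> opt_dirs L" "V \<noteq> 0"
  shows "geodesic_dir L (segment_curve L V) = V"
  unfolding geodesic_dir_def
proof (rule the_equality)
  show "V \<in> opt_dirs L - {0} \<and> (\<forall>u\<in>{0..1}. segment_curve L V u = abw_class (L + u *\<^sub>R V))"
    using V by (simp add: segment_curve_def)
  fix W assume "W \<in> opt_dirs L - {0} \<and> (\<forall>u\<in>{0..1}. segment_curve L V u = abw_class (L + u *\<^sub>R W))"
  then have W: "W \<in> opt_dirs L" "segment_curve L V (1/2) = abw_class (L + (1/2) *\<^sub>R W)"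
    by auto
  have "abw_class (L + (1/2) *\<^sub>R W) = abw_class (L + (1/2) *\<^sub>R V)"
    using W(2) by (simp add: segment_curve_def)
  then show "W = V"
    by (rule abw_class_segment_inj[OF L W(1) V(1), rotated 2]) auto
qed

definition unit_dir :: "('t::{finite,linorder}, 'd::finite) bmat \<Rightarrow> ('t, 'd) curve \<Rightarrow> ('t, 'd) bmat" where
  "unit_dir L \<gamma> = sgn (geodesic_dir L \<gamma>)"

text \<open>Each unit vector of \<open>sym_dirs L\<close> has a small positive multiple that is the
  direction of a geodesic, and normalising undoes the scaling. Thus the whole unit sphere is
  attained before completing.\<close>

lemma unit_dir_image:
  assumes L: "L \<in> block_lower_reg"
  shows "unit_dir L ` nonconst_geodesics (abw_class L) = {V \<in> sym_dirs L. norm V = 1}"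
proof -
  have L': "L \<in> block_lower" using L by (simp add: block_lower_reg_def)
  have "unit_dir L ` nonconst_geodesics (abw_class L) = sgn ` (opt_dirs L - {0})"
    unfolding nonconst_geodesics_eq[OF L] image_image
    by (intro image_cong) (auto simp: unit_dir_def geodesic_dir_segment[OF L])
  also have "\<dots> = {V \<in> sym_dirs L. norm V = 1}"
  proof (intro equalityI subsetI)
    fix v assume "v \<in> sgn ` (opt_dirs L - {0})"
    then show "v \<in> {V \<in> sym_dirs L. norm V = 1}"
      using opt_dirs_subset_sym_dirs[OF L'] subspace_scale[OF subspace_sym_dirs]
      by (auto simp: sgn_div_norm)
  next
    fix v assume v: "v \<in> {V \<in> sym_dirs L. norm V = 1}"
    then obtain e where e: "e > 0" "e *\<^sub>R v \<in> opt_dirs L"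
      using sym_dirs_small_in_opt_dirs[OF L] by blast
    have nv: "norm v = 1" using v by blast
    then have "v = sgn (e *\<^sub>R v)" "e *\<^sub>R v \<noteq> 0"
      using e(1) by (auto simp: sgn_div_norm simp del: norm_eq_1)
    then show "v \<in> sgn ` (opt_dirs L - {0})" using e(2) by blast
  qed
  finally show ?thesis .
qed

lemma unit_dir_geo_angle:
  assumes L: "L \<in> block_lower_reg"
    and "\<gamma> \<in> nonconst_geodesics (abw_class L)" "\<eta> \<in> nonconst_geodesics (abw_class L)"
  shows "geo_angle (abw_class L) \<gamma> \<eta> = arccos (unit_dir L \<gamma> \<bullet> unit_dir L \<eta>)"
proof -
  obtain V W where "V \<in> opt_dirs L" "V \<noteq> 0" "\<gamma> = segment_curve L V"
    and "W \<in> opt_dirs L" "W \<noteq> 0" "\<eta> = segment_curve L W"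
    using assms(2,3) unfolding nonconst_geodesics_eq[OF L] by blast
  then show ?thesis
    by (simp add: unit_dir_def geodesic_dir_segment[OF L] geo_angle_segment[OF L])
qed

lemma angle_rel_eq_kernel:
  assumes L: "L \<in> block_lower_reg"
  shows "angle_rel (abw_class L) = kernel_rel (nonconst_geodesics (abw_class L)) (unit_dir L)"
proof -
  have "norm (unit_dir L \<gamma>) = 1" if "\<gamma> \<in> nonconst_geodesics (abw_class L)" for \<gamma>
    using unit_dir_image[OF L] that by blast
  then have "geo_angle (abw_class L) \<gamma> \<eta> = 0 \<longleftrightarrow> unit_dir L \<gamma> = unit_dir L \<eta>"
    if "\<gamma> \<in> nonconst_geodesics (abw_class L)" "\<eta> \<in> nonconst_geodesics (abw_class L)" for \<gamma> \<eta>
    unfolding unit_dir_geo_angle[OF L that] using that by (intro arccos_inner_eq_0_iff)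
  then show ?thesis
    unfolding angle_rel_def kernel_rel_def by blast
qed

lemma closed_unit_sym_dirs: "closed {V \<in> sym_dirs L. norm V = 1}"
proof -
  have "{V \<in> sym_dirs L. norm V = 1} = sym_dirs L \<inter> sphere 0 1" by auto
  then show ?thesis by (simp add: closed_Int closed_subspace[OF subspace_sym_dirs])
qed

lemma complete_angular_geo_dirs:
  assumes L: "L \<in> block_lower_reg"
  shows "complete_angular (geo_dirs (abw_class L)) (dir_angle (abw_class L)) (lift_map (unit_dir L))
    {V \<in> sym_dirs L. norm V = 1}"
  unfolding geo_dirs_def angle_rel_eq_kernel[OF L]
  using closed_unit_sym_dirs unit_dir_image[OF L] unit_dir_geo_angle[OF L]
  by (intro complete_angular_quotient) auto

definition dir_map :: "('t::{finite,linorder}, 'd::finite) bmat \<Rightarrow> ('t, 'd) direction \<Rightarrow> ('t, 'd) bmat" where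
  "dir_map L = completion_map (lift_map (unit_dir L))"

lemma complete_angular_dir_space:
  assumes L: "L \<in> block_lower_reg"
  shows "complete_angular (dir_space (abw_class L)) (completion_dist (dir_angle (abw_class L))) (dir_map L)
    {V \<in> sym_dirs L. norm V = 1}"
  unfolding dir_space_def dir_map_def
  by (rule complete_angular_completion[OF complete_angular_geo_dirs[OF L]])

lemma dir_map_dir_of:
  assumes L: "L \<in> block_lower_reg" and \<gamma>: "\<gamma> \<in> nonconst_geodesics (abw_class L)"
  shows "dir_map L (dir_of (abw_class L) \<gamma>) = unit_dir L \<gamma>"
    and "dir_of (abw_class L) \<gamma> \<in> dir_space (abw_class L)"
proof -
  have c: "angle_rel (abw_class L) `` {\<gamma>} \<in> geo_dirs (abw_class L)"
    using \<gamma> by (simp add: geo_dirs_def quotientI)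
  show "dir_map L (dir_of (abw_class L) \<gamma>) = unit_dir L \<gamma>"
    unfolding dir_map_def dir_of_def completion_map_embed(1)[OF complete_angular_geo_dirs[OF L] c]
    unfolding angle_rel_eq_kernel[OF L] by (rule lift_map_class[OF \<gamma>])
  show "dir_of (abw_class L) \<gamma> \<in> dir_space (abw_class L)"
    unfolding dir_of_def dir_space_def by (rule completion_map_embed(2)[OF complete_angular_geo_dirs[OF L] c])
qed

text \<open>The completion adds no directions, because geodesics already fill the sphere that models
  it. Hence values on \<open>tangent_vec\<close> determine a map on the whole cone.\<close>

lemma dir_space_eq:
  assumes L: "L \<in> block_lower_reg"
  shows "dir_space (abw_class L) = dir_of (abw_class L) ` nonconst_geodesics (abw_class L)"
proof (intro equalityI subsetI)
  note ca = complete_angular_dir_space[OF L]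
  fix c assume c: "c \<in> dir_space (abw_class L)"
  then have "dir_map L c \<in> unit_dir L ` nonconst_geodesics (abw_class L)"
    using complete_angularD(5)[OF ca] unit_dir_image[OF L] by blast
  then obtain \<gamma> where \<gamma>: "\<gamma> \<in> nonconst_geodesics (abw_class L)" "dir_map L c = unit_dir L \<gamma>" by blast
  then have "c = dir_of (abw_class L) \<gamma>"
    using inj_onD[OF complete_angularD(4)[OF ca]] c dir_map_dir_of[OF L \<gamma>(1)] by metis
  with \<gamma> show "c \<in> dir_of (abw_class L) ` nonconst_geodesics (abw_class L)" by blast
qed (use dir_map_dir_of(2)[OF L] in blast)

lemma reg_nonzero:
  fixes L :: "('t::{finite,linorder}, 'd::finite) bmat"
  assumes "L \<in> block_lower_reg" shows "L \<noteq> 0"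
proof
  assume "L = 0"
  then have "positive_definite (block (0 :: ('t, 'd) bmat) undefined undefined)"
    using assms by (auto simp: block_lower_reg_def)
  moreover have "axis undefined 1 \<noteq> (0 :: real^'d)" by (simp add: axis_eq_0_iff)
  ultimately show False by (force simp: positive_definite_def)
qed

text \<open>\<open>L\<close> itself is a symmetric direction, its Gram blocks being symmetric.
  Without any direction the cone would be empty and have no tip.\<close>

lemma unit_sym_dirs_nonempty: "L \<in> block_lower_reg \<Longrightarrow> sgn L \<in> {V \<in> sym_dirs L. norm V = 1}"
  using reg_nonzero[of L] subspace_scale[OF subspace_sym_dirs, of L]
  by (auto simp: sgn_div_norm block_lower_reg_def sym_dirs_def positive_definite_def)

lemma sym_dirs_cone:
  assumes L: "L \<in> block_lower_reg"
  shows "{r *\<^sub>R a | r a. 0 \<le> r \<and> a \<in> {V \<in> sym_dirs L. norm V = 1}} = sym_dirs L"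
proof (intro equalityI subsetI)
  fix V assume V: "V \<in> sym_dirs L"
  show "V \<in> {r *\<^sub>R a | r a. 0 \<le> r \<and> a \<in> {V \<in> sym_dirs L. norm V = 1}}"
  proof (cases "V = 0")
    case True
    then have "V = 0 *\<^sub>R sgn L" by simp
    with unit_sym_dirs_nonempty[OF L] show ?thesis by blast
  next
    case False
    then have "V = norm V *\<^sub>R sgn V" "norm (sgn V) = 1" by (auto simp: sgn_div_norm norm_sgn)
    moreover have "sgn V \<in> sym_dirs L"
      using V by (simp add: sgn_div_norm subspace_scale[OF subspace_sym_dirs])
    ultimately show ?thesis using norm_ge_zero by blast
  qed
qed (auto intro: subspace_scale[OF subspace_sym_dirs])

section \<open>The isometry and the logarithm\<close>

lemma cone_map_tangent_vec:
  assumes L: "L \<in> block_lower_reg" and \<gamma>: "\<gamma> \<in> nonconst_geodesics (abw_class L)" and r: "0 \<le> r"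
  shows "cone_map (dir_map L) (tangent_vec (abw_class L) \<gamma> r) =
      (r / norm (geodesic_dir L \<gamma>)) *\<^sub>R geodesic_dir L \<gamma>"
    and "tangent_vec (abw_class L) \<gamma> r \<in> tangent_cone (abw_class L)"
  using cone_map_point[OF complete_angular_dir_space[OF L] dir_map_dir_of(2)[OF L \<gamma>] r] dir_map_dir_of(1)[OF L \<gamma>]
  by (simp_all add: tangent_vec_def tangent_cone_def unit_dir_def sgn_div_norm divide_inverse)

lemma cone_map_tip:
  assumes L: "L \<in> block_lower_reg"
  shows "cone_map (dir_map L) (tangent_tip (abw_class L)) = 0"
    and "tangent_tip (abw_class L) \<in> tangent_cone (abw_class L)"
proof -
  note ca = complete_angular_dir_space[OF L]
  obtain x where x: "x \<in> dir_space (abw_class L)"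
    using complete_angularD(5)[OF ca] unit_sym_dirs_nonempty[OF L] by blast
  show "cone_map (dir_map L) (tangent_tip (abw_class L)) = 0"
    "tangent_tip (abw_class L) \<in> tangent_cone (abw_class L)"
    using cone_map_point[OF ca x, of 0]
    by (simp_all add: tangent_tip_def tangent_cone_def cone_tip_eq_point[OF x])
qed

text \<open>Shows that the description in \<open>tangent_iso\<close> has exactly one solution.
  Existence is \<open>cone_map_isometry\<close>; for uniqueness, \<open>dir_space_eq\<close> writes
  every point of the cone as a \<open>tangent_vec\<close>, where the value is prescribed.\<close>

lemma tangent_iso_eq:
  assumes L: "L \<in> block_lower_reg"
  shows "tangent_iso L = restrict (cone_map (dir_map L)) (tangent_cone (abw_class L))"
  unfolding tangent_iso_def
proof (rule the_equality, intro conjI ballI allI impI)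
  let ?X = "abw_class L" and ?F = "cone_map (dir_map L)"
  note ca = complete_angular_dir_space[OF L]
  note iso = cone_map_isometry[OF ca, unfolded sym_dirs_cone[OF L]]
  show "bij_betw (restrict ?F (tangent_cone ?X)) (tangent_cone ?X) (sym_dirs L)"
    using iso(1) by (simp add: tangent_cone_def bij_betw_restrict_eq)
  show "norm (restrict ?F (tangent_cone ?X) x - restrict ?F (tangent_cone ?X) y) = tangent_dist ?X x y"
    if "x \<in> tangent_cone ?X" "y \<in> tangent_cone ?X" for x y
    using iso(2) that by (simp add: tangent_cone_def tangent_dist_def)
  show "restrict ?F (tangent_cone ?X) (tangent_tip ?X) = 0"
    using cone_map_tip[OF L] by simp
  show "restrict ?F (tangent_cone ?X) (tangent_vec ?X \<gamma> r) =
      (r / norm (geodesic_dir L \<gamma>)) *\<^sub>R geodesic_dir L \<gamma>"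
    if "\<gamma> \<in> nonconst_geodesics ?X" "0 \<le> r" for \<gamma> r
    using cone_map_tangent_vec[OF L that] by simp
  fix f
  assume f: "f \<in> extensional (tangent_cone ?X) \<and> bij_betw f (tangent_cone ?X) (sym_dirs L) \<and>
     (\<forall>x\<in>tangent_cone ?X. \<forall>y\<in>tangent_cone ?X. norm (f x - f y) = tangent_dist ?X x y) \<and>
     f (tangent_tip ?X) = 0 \<and>
     (\<forall>\<gamma>\<in>nonconst_geodesics ?X. \<forall>r\<ge>0.
        f (tangent_vec ?X \<gamma> r) = (r / norm (geodesic_dir L \<gamma>)) *\<^sub>R geodesic_dir L \<gamma>)"
  have "f p = ?F p" if p: "p \<in> tangent_cone ?X" for p
  proof -
    obtain c r where c: "c \<in> dir_space ?X" "0 \<le> r" "p = cone_point (dir_space ?X) c r"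
      using coneE[OF p[unfolded tangent_cone_def]] by metis
    then obtain \<gamma> where \<gamma>: "\<gamma> \<in> nonconst_geodesics ?X" "c = dir_of ?X \<gamma>"
      using dir_space_eq[OF L] by blast
    then have "p = tangent_vec ?X \<gamma> r" using c by (simp add: tangent_vec_def)
    then show ?thesis
      using f \<gamma>(1) c(2) cone_map_tangent_vec(1)[OF L \<gamma>(1) c(2)] by metis
  qed
  with f show "f = restrict ?F (tangent_cone ?X)"
    by (auto simp: fun_eq_iff extensional_def)
qed simp

text \<open>In both cases \<open>M ** P - L\<close> is computed as the image of the logarithm, and
  injectivity inverts the map. If the classes agree, this difference is \<open>0\<close> and comes
  from the tip; otherwise it is the direction of the unique geodesic, with norm equal to the
  distance.\<close>

lemma log_map_eq:
  assumes L: "L \<in> block_lower_reg" and M: "M \<in> block_lower"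
    and ex1: "\<exists>!\<gamma>. \<gamma> \<in> geodesics_between (abw_class L) (abw_class M)" and P: "P \<in> abw_opt L M"
  shows "log_map (abw_class L) (abw_class M) =
    Some (the_inv_into (tangent_cone (abw_class L)) (tangent_iso L) (M ** P - L))"
proof -
  let ?X = "abw_class L" and ?V = "M ** P - L"
  have L': "L \<in> block_lower" using L by (simp add: block_lower_reg_def)
  have P': "P \<in> block_orth" "aligned L (M ** P)" using P by (auto simp: abw_opt_iff)
  have MP: "M ** P \<in> block_lower" "abw_class (M ** P) = abw_class M"
    using M P' by (auto simp: abw_class_eq_iff block_lower_mult_orth)
  have V: "?V \<in> opt_dirs L" using P M by (auto simp: opt_dirs_def)
  have dist: "abw_qdist ?X (abw_class M) = norm ?V"
    using abw_qdist_segment[OF L' V, of 0 1] MP by simp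
  have inj: "inj_on (tangent_iso L) (tangent_cone ?X)"
    using cone_map_isometry(1)[OF complete_angular_dir_space[OF L]]
    unfolding tangent_iso_eq[OF L] by (simp add: bij_betw_def tangent_cone_def)
  show ?thesis
  proof (cases "abw_class M = ?X")
    case True
    then have "norm ?V = 0" using dist L' abw_class_eq_iff_dist[OF L' L'] by (simp add: abw_qdist_class)
    then have "?V = tangent_iso L (tangent_tip ?X)"
      using cone_map_tip[OF L] by (simp add: tangent_iso_eq[OF L])
    then have "the_inv_into (tangent_cone ?X) (tangent_iso L) ?V = tangent_tip ?X"
      using the_inv_into_f_f[OF inj cone_map_tip(2)[OF L]] by simp
    with True ex1 show ?thesis by (simp add: log_map_def)
  next
    case False
    then have V0: "?V \<noteq> 0" using MP(2) by auto
    let ?\<gamma> = "segment_curve L ?V"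
    have "?\<gamma> \<in> geodesics_between ?X (abw_class M)"
      using P geodesics_between_eq[OF L M] by blast
    then have the: "(THE \<gamma>. \<gamma> \<in> geodesics_between ?X (abw_class M)) = ?\<gamma>"
      using ex1 by (rule the1_equality[rotated])
    have \<gamma>: "?\<gamma> \<in> nonconst_geodesics ?X"
      using V V0 nonconst_geodesics_eq[OF L] by blast
    have "?V = tangent_iso L (tangent_vec ?X ?\<gamma> (norm ?V))"
      using cone_map_tangent_vec[OF L \<gamma>, of "norm ?V"] V0
      by (simp add: tangent_iso_eq[OF L] geodesic_dir_segment[OF L V V0])
    then have "the_inv_into (tangent_cone ?X) (tangent_iso L) ?V = tangent_vec ?X ?\<gamma> (norm ?V)"
      using the_inv_into_f_f[OF inj cone_map_tangent_vec(2)[OF L \<gamma>, of "norm ?V"]] by simp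
    with False ex1 show ?thesis by (simp add: log_map_def the dist)
  qed
qed

theorem theorem1p9:
  fixes L M :: "('t::{finite,linorder}, 'd::finite) bmat"
  assumes "L \<in> block_lower_reg" and "M \<in> block_lower"
  shows "((\<exists>!\<gamma>. \<gamma> \<in> geodesics_between (abw_class L) (abw_class M)) \<longleftrightarrow>
      (\<forall>t. rank (block (transpose M ** M) t t) = rank (block (transpose M ** L) t t))) \<and>
    ((\<exists>!\<gamma>. \<gamma> \<in> geodesics_between (abw_class L) (abw_class M)) \<or>
      (\<forall>t. rank (block (transpose M ** M) t t) = rank (block (transpose M ** L) t t)) \<longrightarrow>
      (\<exists>P\<in>abw_opt L M. log_map (abw_class L) (abw_class M) =
        Some (the_inv_into (tangent_cone (abw_class L)) (tangent_iso L) (M ** P - L))))"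
  using unique_geodesic_iff_rank[OF assms] log_map_eq[OF assms] abw_opt_nonempty[of L M] by blast

end
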